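(* Let $d\geq 1$ be a fixed integer and let $\mathcal{C}$ be a class of graphs. The problem $d$-Bondage can be solved in polynomial time for graphs in $\mathcal{C}$ if at least one of the following holds: (1) $\mathcal{C}$ is closed under edge deletions and Dominating Set can be solved in polynomial time for $\mathcal{C}$; or (2) $\mathcal{C}$ is the class of $H$-free graphs, where $H$ is a fixed graph with minimum degree $\delta(H)\geq 2$, and Dominating Set can be solved in polynomial time for $\mathcal{C}$; or (3) for every $G\in\mathcal{C}$, $\gamma(G)\leq k$, where $k$ is a fixed constant.
   Context: All graphs are finite, simple and undirected. A set $S\subseteq V(G)$ is a dominating set of a graph $G$ if every vertex of $G$ is in $S$ or is adjacent to an element of $S$; $\gamma(G)$ denotes the minimum cardinality of a dominating set of $G$. Dominating Set is the problem of deciding, given a graph $G$ and an integer $k\geq 1$, whether $\gamma(G)\leq k$. The bondage number $b(G)$ is the minimum number of edges whose removal from $G$ increases the domination number, i.e. the smallest cardinality of a set $E'\subseteq E(G)$ such that $\gamma(G-E')=\gamma(G)+1$, where $G-E'=(V(G),E(G)\setminus E')$. For a fixed integer $d\geq 1$, $d$-Bondage is the decision problem: instance, a graph $G$; question, is $b(G)\leq d$? A class $\mathcal{C}$ of graphs is closed under edge deletions if $G-e\in\mathcal{C}$ for every $G\in\mathcal{C}$ and every $e\in E(G)$. A graph is $H$-free if it has no induced subgraph isomorphic to $H$. A problem is solvable in polynomial time for $\mathcal{C}$ if it is solvable in polynomial time when the input graph is restricted to belong to $\mathcal{C}$. *)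

theory Defs
  imports "HOL-Computational_Algebra.Polynomial" "HOL-Library.Extended_Nat"
begin

section \<open>Graphs\<close>

datatype 'a graph = Graph (verts: "'a set") (edges: "'a set set")

definition simple_graph :: "'a graph \<Rightarrow> bool" where
  "simple_graph G \<longleftrightarrow> finite (verts G) \<and> (\<forall>e\<in>edges G. e \<subseteq> verts G \<and> card e = 2)"

definition dominating_set :: "'a graph \<Rightarrow> 'a set \<Rightarrow> bool" where
  "dominating_set G S \<longleftrightarrow>
     S \<subseteq> verts G \<and> (\<forall>v\<in>verts G. v \<in> S \<or> (\<exists>u\<in>S. {u, v} \<in> edges G))"

definition domination_number :: "'a graph \<Rightarrow> nat" where
  "domination_number G = Min (card ` {S. dominating_set G S})"

definition delete_edges :: "'a graph \<Rightarrow> 'a set set \<Rightarrow> 'a graph" where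
  "delete_edges G F = Graph (verts G) (edges G - F)"

text \<open>
  If no set of edges has the required property (i.e. if \<open>G\<close> has no edges), the infimum
  is over the empty set and the bondage number is \<open>\<infinity>\<close>.
\<close>

definition bondage_number :: "'a graph \<Rightarrow> enat" where
  "bondage_number G =
     (INF F \<in> {F. F \<subseteq> edges G \<and>
                  domination_number (delete_edges G F) = domination_number G + 1}.
        enat (card F))"

definition vertex_degree :: "'a graph \<Rightarrow> 'a \<Rightarrow> nat" where
  "vertex_degree G v = card {e \<in> edges G. v \<in> e}"

text \<open>Meaningful only for graphs with at least one vertex.\<close>

definition min_degree :: "'a graph \<Rightarrow> nat" where
  "min_degree G = Min (vertex_degree G ` verts G)"

definition induced_subgraph :: "'a graph \<Rightarrow> 'a set \<Rightarrow> 'a graph" where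
  "induced_subgraph G S = Graph S {e \<in> edges G. e \<subseteq> S}"

definition isomorphic :: "'a graph \<Rightarrow> 'b graph \<Rightarrow> bool" where
  "isomorphic G H \<longleftrightarrow>
     (\<exists>f. bij_betw f (verts G) (verts H) \<and>
          (\<forall>u\<in>verts G. \<forall>v\<in>verts G. {u, v} \<in> edges G \<longleftrightarrow> {f u, f v} \<in> edges H))"

definition induced_free :: "'b graph \<Rightarrow> 'a graph \<Rightarrow> bool" where
  "induced_free H G \<longleftrightarrow> \<not> (\<exists>S \<subseteq> verts G. isomorphic (induced_subgraph G S) H)"

text \<open>
  Input graphs have vertex set \<open>{0, ..., n - 1}\<close>; every finite graph is isomorphic to such a
  graph. A class of graphs is an arbitrary subset of \<open>graphs\<close>; it is not
  required to be closed under isomorphism.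
\<close>

definition graphs :: "nat graph set" where
  "graphs = {G. simple_graph G \<and> (\<exists>n. verts G = {..<n})}"

definition closed_under_edge_deletions :: "'a graph set \<Rightarrow> bool" where
  "closed_under_edge_deletions C \<longleftrightarrow> (\<forall>G\<in>C. \<forall>e\<in>edges G. delete_edges G {e} \<in> C)"


section \<open>Deterministic multi-tape Turing machines\<close>

text \<open>
  States, tape symbols and tapes are numbered from \<open>0\<close>, and the fields \<open>num_states\<close>,
  \<open>num_symbols\<close>, \<open>num_tapes\<close> give their finite numbers. Symbol \<open>0\<close> is the blank, and
  symbols \<open>1\<close> and \<open>2\<close> represent the input bits. Given the current state and the list of the
  symbols under the heads (one per tape), \<open>delta\<close> returns the next state and, for every
  tape, the symbol to be written and the move of the head. Its values outside the finite
  domain described in \<open>wf_tm\<close> are irrelevant.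
\<close>

datatype move = Move_Left | Stay | Move_Right

record tm =
  num_tapes :: nat
  num_symbols :: nat
  num_states :: nat
  start_state :: nat
  accept_state :: nat
  reject_state :: nat
  delta :: "nat \<Rightarrow> nat list \<Rightarrow> nat \<times> (nat \<times> move) list"

definition wf_tm :: "tm \<Rightarrow> bool" where
  "wf_tm M \<longleftrightarrow>
     num_tapes M \<ge> 1 \<and> num_symbols M \<ge> 3 \<and>
     start_state M < num_states M \<and>
     accept_state M < num_states M \<and>
     reject_state M < num_states M \<and>
     accept_state M \<noteq> reject_state M \<and>
     (\<forall>q < num_states M. \<forall>xs. length xs = num_tapes M \<and> (\<forall>x\<in>set xs. x < num_symbols M) \<longrightarrow>
        (case delta M q xs of (q', acts) \<Rightarrow>
           q' < num_states M \<and> length acts = num_tapes M \<and>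
           (\<forall>(s, m)\<in>set acts. s < num_symbols M)))"

text \<open>Tapes are two-way infinite: the contents of all cells together with the head position.\<close>

type_synonym tape = "(int \<Rightarrow> nat) \<times> int"
type_synonym config = "nat \<times> tape list"

fun read_tape :: "tape \<Rightarrow> nat" where
  "read_tape (f, h) = f h"

fun move_head :: "move \<Rightarrow> int \<Rightarrow> int" where
  "move_head Move_Left h = h - 1"
| "move_head Stay h = h"
| "move_head Move_Right h = h + 1"

fun act_tape :: "nat \<times> move \<Rightarrow> tape \<Rightarrow> tape" where
  "act_tape (s, m) (f, h) = (f(h := s), move_head m h)"

text \<open>
  Configurations in the accepting or the rejecting state are fixed points, so being in such
  a state after \<open>t\<close> steps means having halted within \<open>t\<close> steps.
\<close>

fun tm_step :: "tm \<Rightarrow> config \<Rightarrow> config" where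
  "tm_step M (q, ts) =
     (if q = accept_state M \<or> q = reject_state M then (q, ts)
      else case delta M q (map read_tape ts) of (q', acts) \<Rightarrow> (q', map2 act_tape acts ts))"

definition blank_tape :: tape where
  "blank_tape = (\<lambda>_. 0, 0)"

definition input_tape :: "bool list \<Rightarrow> tape" where
  "input_tape w =
     (\<lambda>i. if 0 \<le> i \<and> i < int (length w) then (if w ! nat i then 2 else 1) else 0, 0)"

definition initial_config :: "tm \<Rightarrow> bool list \<Rightarrow> config" where
  "initial_config M w = (start_state M, input_tape w # replicate (num_tapes M - 1) blank_tape)"

definition accepts_within :: "tm \<Rightarrow> bool list \<Rightarrow> nat \<Rightarrow> bool" where
  "accepts_within M w t \<longleftrightarrow> fst ((tm_step M ^^ t) (initial_config M w)) = accept_state M"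

definition rejects_within :: "tm \<Rightarrow> bool list \<Rightarrow> nat \<Rightarrow> bool" where
  "rejects_within M w t \<longleftrightarrow> fst ((tm_step M ^^ t) (initial_config M w)) = reject_state M"

text \<open>
  The decision problem \<open>Q\<close> with instances encoded by \<open>enc\<close>, its inputs being restricted
  to \<open>I\<close>. Nothing is required of the machine on words that do not encode an element of \<open>I\<close>.
\<close>

definition poly_time_solvable :: "'i set \<Rightarrow> ('i \<Rightarrow> bool list) \<Rightarrow> ('i \<Rightarrow> bool) \<Rightarrow> bool" where
  "poly_time_solvable I enc Q \<longleftrightarrow>
     (\<exists>M (p :: nat poly). wf_tm M \<and>
        (\<forall>x\<in>I. if Q x then accepts_within M (enc x) (poly p (length (enc x)))
                else rejects_within M (enc x) (poly p (length (enc x)))))"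


section \<open>The decision problems\<close>

text \<open>
  A graph on \<open>{0, ..., n - 1}\<close> is encoded by \<open>n\<close> in unary, a delimiter, and its adjacency
  matrix row by row.
\<close>

definition encode_graph :: "nat graph \<Rightarrow> bool list" where
  "encode_graph G =
     (let n = card (verts G) in
       replicate n True @ [False] @
       concat (map (\<lambda>i. map (\<lambda>j. {i, j} \<in> edges G) [0..<n]) [0..<n]))"

text \<open>
  The number \<open>k\<close> is appended in unary. As \<open>\<gamma>(G) \<le> |V(G)|\<close>, all \<open>k \<ge> |V(G)|\<close> give yes-instances,
  so polynomial-time solvability is the same as for \<open>k\<close> in binary.
\<close>

fun encode_graph_nat :: "nat graph \<times> nat \<Rightarrow> bool list" where
  "encode_graph_nat (G, k) = encode_graph G @ replicate k True"

definition dominating_set_poly_time :: "nat graph set \<Rightarrow> bool" where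
  "dominating_set_poly_time C \<longleftrightarrow>
     poly_time_solvable {(G, k). G \<in> C \<and> k \<ge> 1} encode_graph_nat
       (\<lambda>(G, k). domination_number G \<le> k)"

definition bondage_poly_time :: "nat \<Rightarrow> nat graph set \<Rightarrow> bool" where
  "bondage_poly_time d C \<longleftrightarrow>
     poly_time_solvable C encode_graph (\<lambda>G. bondage_number G \<le> enat d)"

end

theory Submission
  imports Defs
begin

text \<open>
  Deleting one edge raises the domination number by at most one. Hence \<open>b(G) \<le> d\<close> holds exactly if
  there is a set \<open>F\<close> of at most \<open>d\<close> edges with \<open>\<gamma>(G) < \<gamma>(G - F)\<close>, and it suffices to try all lists of
  \<open>d\<close> edges, that is, all lists of \<open>2 * d\<close> vertices (\<open>bondage_number_le_iff_list\<close>). For fixed \<open>d\<close>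
  there are polynomially many of them. To recognise \<open>\<gamma>(G) < \<gamma>(G - F)\<close> one looks for a threshold \<open>k\<close>
  with \<open>\<gamma>(G) \<le> k\<close> but not \<open>\<gamma>(G - F) \<le> k\<close>.

  If the class is closed under edge deletions, both questions are instances of Dominating Set for the
  class. If the class consists of the \<open>H\<close>-free graphs, \<open>G - F\<close> may fall outside of it. Instead, one
  guesses for every end \<open>x\<close> of a deleted edge a vertex \<open>y\<close> that dominates \<open>x\<close> in \<open>G - F\<close>, and attaches
  a pendant vertex to each guessed \<open>y\<close>. The dominating sets of the graph with pendants are, up to
  replacing pendants by their neighbours, the dominating sets of \<open>G\<close> that contain all the \<open>y\<close>, and these
  also dominate \<open>G - F\<close>, because vertices off \<open>F\<close> lose no edge
  (\<open>domination_number_delete_iff_pendants\<close>). A pendant vertex cannot belong to an induced copy of a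
  graph of minimum degree at least two, so the new graph is again \<open>H\<close>-free
  (\<open>induced_free_add_pendants\<close>). If \<open>\<gamma>\<close> is bounded on the class by a constant, \<open>\<gamma>(G) \<le> j\<close> for the
  finitely many relevant \<open>j\<close> is a condition on \<open>j\<close> vertices, and no Dominating Set machine is called.

  In all three cases, \<open>b(G) \<le> d\<close> becomes a formula with a fixed number of quantifiers over vertices
  whose atoms are comparisons of vertices, adjacency, and calls of the given machine on a graph that
  is definable from the quantified vertices. The larger part of the text shows that such formulas are
  evaluated by polynomial-time Turing machines. A small while language on named tapes serves as the
  programming language; its programs become machines whose states are the finitely many stacks of
  commands that can be pending (\<open>program_machine\<close>). A vertex variable is the head position on
  a tape with \<open>n\<close> marked cells, so that a quantifier is a loop moving that head (\<open>implements_for\<close>).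
  A call of the given machine records its computation and afterwards runs it backwards, which
  leaves all tapes as they were, so that it can be called again (\<open>runs_call\<close>).
\<close>

section \<open>Domination after deleting edges\<close>

lemma domination_number_le_iff:
  assumes "finite (verts G)"
  shows "domination_number G \<le> k \<longleftrightarrow> (\<exists>S. dominating_set G S \<and> card S \<le> k)"
proof -
  have "finite {S. dominating_set G S}"
    by (rule finite_subset[of _ "Pow (verts G)"]) (auto simp: dominating_set_def assms)
  moreover have "dominating_set G (verts G)"
    by (auto simp: dominating_set_def)
  ultimately show ?thesis
    unfolding domination_number_def by (subst Min_le_iff) auto
qed

lemma delete_edges_simps [simp]:
  "verts (delete_edges G F) = verts G" "edges (delete_edges G F) = edges G - F"
  "delete_edges (delete_edges G F) F' = delete_edges G (F \<union> F')" "delete_edges G {} = G"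
  by (auto simp: delete_edges_def)

lemma simple_graph_delete_edges: "simple_graph G \<Longrightarrow> simple_graph (delete_edges G F)"
  by (auto simp: simple_graph_def)

text \<open>
  At most one end of the edge is outside a given dominating set and dominated from the other end;
  adding that end repairs the set.
\<close>

lemma domination_number_delete_edge:
  assumes G: "simple_graph G"
  shows "domination_number (delete_edges G {e}) \<le> domination_number G + 1"
proof -
  have fin: "finite (verts G)" using G by (simp add: simple_graph_def)
  obtain S where S: "dominating_set G S" "card S \<le> domination_number G"
    using domination_number_le_iff[OF fin, of "domination_number G"] by auto
  have "finite S" using S(1) fin by (auto simp: dominating_set_def intro: finite_subset)
  show ?thesis
  proof (cases "\<exists>x\<in>e. x \<in> verts G \<and> x \<notin> S \<and> e \<in> edges G")
    case True
    then obtain x where x: "x \<in> e" "x \<in> verts G" "x \<notin> S" "e \<in> edges G" by blast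
    have "card e = 2" using G x by (simp add: simple_graph_def)
    have "dominating_set (delete_edges G {e}) (insert x S)"
      unfolding dominating_set_def
    proof (intro conjI ballI)
      fix v assume v: "v \<in> verts (delete_edges G {e})"
      show "v \<in> insert x S \<or> (\<exists>u\<in>insert x S. {u, v} \<in> edges (delete_edges G {e}))"
      proof (cases "v \<in> insert x S")
        case False
        then obtain u where u: "u \<in> S" "{u, v} \<in> edges G"
          using S(1) v by (auto simp: dominating_set_def)
        have "{u, v} \<noteq> e" using u False x by auto
        then show ?thesis using u by auto
      qed simp
    qed (use S(1) x in \<open>auto simp: dominating_set_def\<close>)
    moreover have "card (insert x S) \<le> domination_number G + 1"
      using S(2) \<open>finite S\<close> x(3) by simp
    ultimately show ?thesis using domination_number_le_iff[of "delete_edges G {e}"] fin by auto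
  next
    case False
    have "dominating_set (delete_edges G {e}) S"
      unfolding dominating_set_def
    proof (intro conjI ballI)
      fix v assume v: "v \<in> verts (delete_edges G {e})"
      show "v \<in> S \<or> (\<exists>u\<in>S. {u, v} \<in> edges (delete_edges G {e}))"
      proof (cases "v \<in> S")
        case vS: False
        then obtain u where u: "u \<in> S" "{u, v} \<in> edges G"
          using S(1) v by (auto simp: dominating_set_def)
        have "{u, v} \<noteq> e" using u vS v False by auto
        then show ?thesis using u by auto
      qed simp
    qed (use S(1) in \<open>auto simp: dominating_set_def\<close>)
    then have "domination_number (delete_edges G {e}) \<le> domination_number G"
      using domination_number_le_iff[of "delete_edges G {e}"] fin S(2) by auto
    then show ?thesis by simp
  qed
qed

text \<open>
  The definition asks for an increase by exactly one. As the domination number grows by at most one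
  with every single edge, a set with a larger increase contains one with increase one.
\<close>

lemma bondage_number_le_iff:
  assumes G: "simple_graph G"
  shows "bondage_number G \<le> enat d \<longleftrightarrow>
    (\<exists>F \<subseteq> edges G. card F \<le> d \<and> domination_number G < domination_number (delete_edges G F))"
proof -
  let ?B = "{F. F \<subseteq> edges G \<and> domination_number (delete_edges G F) = domination_number G + 1}"
  have fin: "finite (verts G)" using G by (simp add: simple_graph_def)
  have finE: "finite (edges G)"
    by (rule finite_subset[of _ "Pow (verts G)"]) (use G in \<open>auto simp: simple_graph_def\<close>)
  have exact: "\<exists>F' \<subseteq> F. domination_number (delete_edges G F') = domination_number G + 1"
    if "finite F" "domination_number G < domination_number (delete_edges G F)" for F
    using that
  proof (induction F rule: finite_induct)
    case (insert e F)
    show ?case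
    proof (cases "domination_number G < domination_number (delete_edges G F)")
      case True
      then show ?thesis using insert.IH by blast
    next
      case False
      have "domination_number (delete_edges G (insert e F)) \<le> domination_number (delete_edges G F) + 1"
        using domination_number_delete_edge[OF simple_graph_delete_edges[OF G, of F], of e] by simp
      then have "domination_number (delete_edges G (insert e F)) = domination_number G + 1"
        using False insert.prems by simp
      then show ?thesis by blast
    qed
  qed simp
  show ?thesis
  proof
    assume le: "bondage_number G \<le> enat d"
    have "?B \<noteq> {}"
    proof
      assume "?B = {}"
      then have "bondage_number G = \<infinity>"
        unfolding bondage_number_def by (simp only: image_empty Inf_empty top_enat_def)
      then show False using le by simp
    qed
    then have "bondage_number G \<in> (\<lambda>F. enat (card F)) ` ?B"
      unfolding bondage_number_def using wellorder_InfI[of _ "(\<lambda>F. enat (card F)) ` ?B"] by blast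
    then show "\<exists>F \<subseteq> edges G. card F \<le> d \<and> domination_number G < domination_number (delete_edges G F)"
      using le by auto
  next
    assume "\<exists>F \<subseteq> edges G. card F \<le> d \<and> domination_number G < domination_number (delete_edges G F)"
    then obtain F where F: "F \<subseteq> edges G" "card F \<le> d" "domination_number G < domination_number (delete_edges G F)"
      by blast
    have finF: "finite F" using F(1) finE finite_subset by blast
    obtain F' where F': "F' \<subseteq> F" "domination_number (delete_edges G F') = domination_number G + 1"
      using exact[OF finF F(3)] by blast
    have "card F' \<le> d" using card_mono[OF finF F'(1)] F(2) by simp
    moreover have "F' \<in> ?B" using F' F(1) by blast
    ultimately show "bondage_number G \<le> enat d"
      unfolding bondage_number_def by (intro INF_lower2[of F']) auto
  qed
qed

text \<open>
  The first halves of the edges are listed before the second halves, so that a condition on all ends of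
  the deleted edges ranges over all positions of the list.
\<close>

definition edge_set :: "nat \<Rightarrow> 'a list \<Rightarrow> 'a set set" where
  "edge_set d xs = (\<lambda>l. {xs ! l, xs ! (d + l)}) ` {..<d}"

lemma list_of_set:
  assumes "finite S" "S \<noteq> {}" "card S \<le> r"
  obtains L where "length L = r" "set L = S"
proof -
  obtain L where L: "set L = S" "distinct L" using finite_distinct_list[OF assms(1)] by blast
  have "length L = card S" using L distinct_card by metis
  moreover have "hd L \<in> S" using L assms(2) by (cases L) auto
  ultimately have "length (L @ replicate (r - card S) (hd L)) = r" "set (L @ replicate (r - card S) (hd L)) = S"
    using L assms(3) by auto
  then show ?thesis using that by blast
qed

text \<open>
  A set of fewer than \<open>d\<close> edges is listed with repetitions. This is possible since the empty set of
  edges does not increase the domination number.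
\<close>

lemma bondage_number_le_iff_list:
  assumes G: "simple_graph G" and d: "d \<ge> 1"
  shows "bondage_number G \<le> enat d \<longleftrightarrow>
    (\<exists>xs. length xs = 2 * d \<and> set xs \<subseteq> verts G \<and> (\<forall>l<d. {xs ! l, xs ! (d + l)} \<in> edges G) \<and>
       domination_number G < domination_number (delete_edges G (edge_set d xs)))"
    (is "_ \<longleftrightarrow> ?R")
proof
  assume "bondage_number G \<le> enat d"
  then obtain F where F: "F \<subseteq> edges G" "card F \<le> d" "domination_number G < domination_number (delete_edges G F)"
    using bondage_number_le_iff[OF G] by blast
  have finE: "finite (edges G)"
    by (rule finite_subset[of _ "Pow (verts G)"]) (use G in \<open>auto simp: simple_graph_def\<close>)
  have "F \<noteq> {}" using F(3) by auto
  then obtain L where L: "length L = d" "set L = F"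
    using list_of_set[of F d] F finE finite_subset by metis
  have "\<exists>u v. e = {u, v}" if "e \<in> F" for e
    using G F(1) that unfolding simple_graph_def by (metis card_2_iff subsetD)
  then obtain f g where fg: "\<And>e. e \<in> F \<Longrightarrow> e = {f e, g e}" by metis
  define xs where "xs = map f L @ map g L"
  have nth: "{xs ! l, xs ! (d + l)} = L ! l" if "l < d" for l
    using that L fg[of "L ! l"] nth_mem[of l L] by (auto simp: xs_def nth_append)
  have "edge_set d xs = F"
    unfolding edge_set_def L(2)[symmetric] set_conv_nth using nth L(1) by (auto simp: image_iff)
  moreover have "\<forall>l<d. {xs ! l, xs ! (d + l)} \<in> edges G"
    using nth L F(1) nth_mem by fastforce
  moreover have "set xs \<subseteq> verts G"
    using fg F(1) G L(2) by (fastforce simp: xs_def simple_graph_def)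
  moreover have "length xs = 2 * d" using L by (simp add: xs_def)
  ultimately show ?R using F(3) by blast
next
  assume ?R
  then obtain xs where xs: "\<forall>l<d. {xs ! l, xs ! (d + l)} \<in> edges G"
    "domination_number G < domination_number (delete_edges G (edge_set d xs))" by blast
  have "card (edge_set d xs) \<le> d"
    unfolding edge_set_def using card_image_le[of "{..<d}"] by fastforce
  moreover have "edge_set d xs \<subseteq> edges G" using xs(1) by (auto simp: edge_set_def)
  ultimately show "bondage_number G \<le> enat d"
    using bondage_number_le_iff[OF G] xs(2) by blast
qed

lemma simple_graph_if_graphs: "G \<in> graphs \<Longrightarrow> simple_graph G"
  by (simp add: graphs_def)

lemma verts_graphs:
  assumes "G \<in> graphs"
  shows "verts G = {..<card (verts G)}"
proof -
  obtain n where n: "verts G = {..<n}" using assms unfolding graphs_def by blast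
  show ?thesis unfolding n by (simp only: card_lessThan)
qed

lemma mem_verts_iff:
  assumes "G \<in> graphs"
  shows "v \<in> verts G \<longleftrightarrow> v < card (verts G)"
  by (subst verts_graphs[OF assms]) (rule lessThan_iff)

lemma closed_delete_edges:
  assumes "closed_under_edge_deletions C" "G \<in> C" "F \<subseteq> edges G" "finite F"
  shows "delete_edges G F \<in> C"
  using assms(4,3)
proof (induction F rule: finite_induct)
  case empty
  then show ?case using assms(2) by simp
next
  case (insert e F)
  then have "delete_edges G F \<in> C" "e \<in> edges (delete_edges G F)" by auto
  then have "delete_edges (delete_edges G F) {e} \<in> C"
    using assms(1) unfolding closed_under_edge_deletions_def by blast
  then show ?case by simp
qed

section \<open>Forcing vertices into a dominating set by pendant vertices\<close>

text \<open>
  The vertex \<open>n + q\<close> is the pendant at the \<open>q\<close>-th entry of the list. Several pendants at one vertex are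
  harmless, so entries may repeat.
\<close>

definition add_pendants :: "nat graph \<Rightarrow> nat list \<Rightarrow> nat graph" where
  "add_pendants G ys = Graph {..<card (verts G) + length ys}
     (edges G \<union> (\<lambda>q. {ys ! q, card (verts G) + q}) ` {..<length ys})"

lemma edges_below:
  assumes "G \<in> graphs" "{u, v} \<in> edges G"
  shows "u < card (verts G)" "v < card (verts G)" "u \<noteq> v"
proof -
  have "{u, v} \<subseteq> verts G" "card {u, v} = 2"
    using simple_graph_if_graphs[OF assms(1)] assms(2) unfolding simple_graph_def by blast+
  then show "u < card (verts G)" "v < card (verts G)" "u \<noteq> v"
    using mem_verts_iff[OF assms(1)] by (auto simp: card_insert_if split: if_splits)
qed

lemma add_pendants_edges:
  assumes G: "G \<in> graphs" and ys: "set ys \<subseteq> verts G"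
  shows "i < card (verts G) \<Longrightarrow> j < card (verts G) \<Longrightarrow> {i, j} \<in> edges (add_pendants G ys) \<longleftrightarrow> {i, j} \<in> edges G"
    and "q < length ys \<Longrightarrow> {i, card (verts G) + q} \<in> edges (add_pendants G ys) \<longleftrightarrow> i = ys ! q"
proof -
  have lt: "ys ! r < card (verts G)" if "r < length ys" for r
    by (rule iffD1[OF mem_verts_iff[OF G] subsetD[OF ys nth_mem[OF that]]])
  show "i < card (verts G) \<Longrightarrow> j < card (verts G) \<Longrightarrow> {i, j} \<in> edges (add_pendants G ys) \<longleftrightarrow> {i, j} \<in> edges G"
    by (auto simp: add_pendants_def doubleton_eq_iff)
  show "{i, card (verts G) + q} \<in> edges (add_pendants G ys) \<longleftrightarrow> i = ys ! q" if "q < length ys"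
    using that lt edges_below[OF G, of i "card (verts G) + q"]
    by (auto simp: add_pendants_def doubleton_eq_iff) (metis lt not_add_less1)+
qed

lemma add_pendants_in_graphs:
  assumes G: "G \<in> graphs" and ys: "set ys \<subseteq> verts G"
  shows "add_pendants G ys \<in> graphs"
proof -
  have lt: "ys ! r < card (verts G)" if "r < length ys" for r
    by (rule iffD1[OF mem_verts_iff[OF G] subsetD[OF ys nth_mem[OF that]]])
  have "e \<subseteq> {..<card (verts G) + length ys} \<and> card e = 2" if e: "e \<in> edges (add_pendants G ys)" for e
  proof -
    from e consider "e \<in> edges G" | q where "q < length ys" "e = {ys ! q, card (verts G) + q}"
      by (auto simp: add_pendants_def)
    then show ?thesis
    proof cases
      case 1
      then have "e \<subseteq> verts G" "card e = 2" using simple_graph_if_graphs[OF G] by (auto simp: simple_graph_def)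
      then show ?thesis using mem_verts_iff[OF G] by (auto simp: trans_less_add1)
    next
      case 2
      then show ?thesis using lt[of q] by auto
    qed
  qed
  moreover have "verts (add_pendants G ys) = {..<card (verts G) + length ys}"
    by (simp add: add_pendants_def)
  ultimately show ?thesis
    unfolding graphs_def simple_graph_def mem_Collect_eq by (metis finite_lessThan)
qed

text \<open>
  A pendant vertex is dominated by itself or by its neighbour; replacing every pendant in a dominating
  set by its neighbour does not enlarge the set and puts all the listed vertices into it.
\<close>

lemma domination_number_add_pendants:
  assumes G: "G \<in> graphs" and ys: "set ys \<subseteq> verts G"
  shows "domination_number (add_pendants G ys) \<le> k \<longleftrightarrow>
    (\<exists>S. dominating_set G S \<and> set ys \<subseteq> S \<and> card S \<le> k)"
proof -
  let ?n = "card (verts G)" and ?G = "add_pendants G ys"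
  have V: "v \<in> verts G \<longleftrightarrow> v < ?n" for v by (rule mem_verts_iff[OF G])
  have V': "verts ?G = {..<?n + length ys}" by (simp add: add_pendants_def)
  note E = add_pendants_edges[OF G ys]
  have lt: "ys ! r < ?n" if "r < length ys" for r
    by (rule iffD1[OF V subsetD[OF ys nth_mem[OF that]]])
  have "(\<exists>D. dominating_set ?G D \<and> card D \<le> k) \<longleftrightarrow> (\<exists>S. dominating_set G S \<and> set ys \<subseteq> S \<and> card S \<le> k)"
  proof
    assume "\<exists>D. dominating_set ?G D \<and> card D \<le> k"
    then obtain D where D: "dominating_set ?G D" "card D \<le> k" by blast
    define r where "r = (\<lambda>x. if x < ?n then x else ys ! (x - ?n))"
    have finD: "finite D" using D(1) V' by (auto simp: dominating_set_def intro: finite_subset)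
    have old: "u \<in> r ` D" if "u \<in> D" "u < ?n" for u
      using that by (force simp: r_def image_iff)
    have new: "ys ! q \<in> r ` D" if "q < length ys" for q
    proof -
      have "?n + q \<in> verts ?G" using that V' by simp
      then consider "?n + q \<in> D" | u where "u \<in> D" "{u, ?n + q} \<in> edges ?G"
        using D(1) unfolding dominating_set_def by blast
      then show ?thesis
      proof cases
        case 1
        have "r (?n + q) = ys ! q" by (simp add: r_def)
        then show ?thesis using 1 by (metis imageI)
      next
        case 2
        then show ?thesis using E(2)[OF that] lt[OF that] old by auto
      qed
    qed
    have "dominating_set G (r ` D)"
      unfolding dominating_set_def
    proof (intro conjI ballI)
      show "r ` D \<subseteq> verts G"
        using D(1) V V' lt by (auto simp: dominating_set_def r_def subset_iff)
      fix v assume "v \<in> verts G"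
      then have v: "v < ?n" using V by blast
      then have "v \<in> verts ?G" using V' by simp
      then consider "v \<in> D" | u where "u \<in> D" "{u, v} \<in> edges ?G"
        using D(1) unfolding dominating_set_def by blast
      then show "v \<in> r ` D \<or> (\<exists>u\<in>r ` D. {u, v} \<in> edges G)"
      proof cases
        case 1
        then show ?thesis using old v by blast
      next
        case 2
        show ?thesis
        proof (cases "u < ?n")
          case True
          then show ?thesis using 2 old E(1)[OF True v] by blast
        next
          case False
          have "u < ?n + length ys" using D(1) V' 2 by (auto simp: dominating_set_def)
          then obtain q where "u = ?n + q" "q < length ys"
            using False by (metis add_less_cancel_left le_Suc_ex not_less)
          then show ?thesis using 2 E(2)[of q v] new by (auto simp: insert_commute)
        qed
      qed
    qed
    moreover have "set ys \<subseteq> r ` D" using new by (auto simp: set_conv_nth)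
    moreover have "card (r ` D) \<le> k" using D(2) card_image_le[OF finD, of r] by simp
    ultimately show "\<exists>S. dominating_set G S \<and> set ys \<subseteq> S \<and> card S \<le> k" by blast
  next
    assume "\<exists>S. dominating_set G S \<and> set ys \<subseteq> S \<and> card S \<le> k"
    then obtain S where S: "dominating_set G S" "set ys \<subseteq> S" "card S \<le> k" by blast
    have "dominating_set ?G S"
      unfolding dominating_set_def
    proof (intro conjI ballI)
      show "S \<subseteq> verts ?G" using S(1) V V' by (auto simp: dominating_set_def trans_less_add1)
      fix v assume v: "v \<in> verts ?G"
      show "v \<in> S \<or> (\<exists>u\<in>S. {u, v} \<in> edges ?G)"
      proof (cases "v < ?n")
        case True
        then show ?thesis using S(1) V by (auto simp: dominating_set_def add_pendants_def)
      next
        case False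
        then obtain q where q: "v = ?n + q" "q < length ys"
          using v V' by (metis add_less_cancel_left le_Suc_ex lessThan_iff not_less)
        then show ?thesis using E(2)[of q "ys ! q"] S(2) nth_mem[of q ys] by blast
      qed
    qed
    then show "\<exists>D. dominating_set ?G D \<and> card D \<le> k" using S(3) by blast
  qed
  then show ?thesis
    using domination_number_le_iff[of ?G k] V' by simp
qed

text \<open>
  A vertex that is not an end of a deleted edge keeps all its neighbours. So a dominating set of \<open>G\<close>
  dominates \<open>G - F\<close> as soon as it contains a dominator in \<open>G - F\<close> for every end of a deleted edge. The
  right-hand side no longer refers to the domination number of \<open>G - F\<close>.
\<close>

lemma domination_number_delete_iff_pendants:
  assumes G: "G \<in> graphs" and xs: "set xs \<subseteq> verts G" "length xs = 2 * d"
  shows "domination_number (delete_edges G (edge_set d xs)) \<le> k \<longleftrightarrow>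
    (\<exists>ys. length ys = 2 * d \<and> set ys \<subseteq> verts G \<and>
       (\<forall>m<2 * d. ys ! m = xs ! m \<or> {ys ! m, xs ! m} \<in> edges (delete_edges G (edge_set d xs))) \<and>
       domination_number (add_pendants G ys) \<le> k)"
    (is "_ \<longleftrightarrow> (\<exists>ys. ?P ys)")
proof -
  let ?G = "delete_edges G (edge_set d xs)"
  have fin: "finite (verts ?G)" using simple_graph_if_graphs[OF G] by (simp add: simple_graph_def)
  show ?thesis
  proof
    assume "domination_number ?G \<le> k"
    then obtain S where S: "dominating_set ?G S" "card S \<le> k"
      using domination_number_le_iff[OF fin] by blast
    have "\<exists>y\<in>S. y = x \<or> {y, x} \<in> edges ?G" if "x \<in> set xs" for x
    proof -
      have "x \<in> verts ?G" using that xs(1) by auto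
      then have "x \<in> S \<or> (\<exists>u\<in>S. {u, x} \<in> edges ?G)"
        using S(1) unfolding dominating_set_def by blast
      then show ?thesis by metis
    qed
    then obtain f where f: "\<And>x. x \<in> set xs \<Longrightarrow> f x \<in> S \<and> (f x = x \<or> {f x, x} \<in> edges ?G)"
      by metis
    have sub: "set (map f xs) \<subseteq> S" using f by auto
    have SV: "S \<subseteq> verts G" using S(1) by (auto simp: dominating_set_def)
    have "dominating_set G S" using S(1) by (auto simp: dominating_set_def)
    then have "domination_number (add_pendants G (map f xs)) \<le> k"
      using domination_number_add_pendants[OF G, of "map f xs" k] sub SV S(2) by blast
    moreover have "\<forall>m<2 * d. map f xs ! m = xs ! m \<or> {map f xs ! m, xs ! m} \<in> edges ?G"
      using f[OF nth_mem] xs(2) by simp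
    ultimately have "?P (map f xs)" using sub SV xs(2) by auto
    then show "\<exists>ys. ?P ys" by blast
  next
    assume "\<exists>ys. ?P ys"
    then obtain ys where ys: "length ys = 2 * d" "set ys \<subseteq> verts G"
      and dom: "\<And>m. m < 2 * d \<Longrightarrow> ys ! m = xs ! m \<or> {ys ! m, xs ! m} \<in> edges ?G"
      and "domination_number (add_pendants G ys) \<le> k" by blast
    then obtain S where S: "dominating_set G S" "set ys \<subseteq> S" "card S \<le> k"
      using domination_number_add_pendants[OF G ys(2)] by blast
    have "dominating_set ?G S"
      unfolding dominating_set_def
    proof (intro conjI ballI)
      fix v assume v: "v \<in> verts ?G"
      show "v \<in> S \<or> (\<exists>u\<in>S. {u, v} \<in> edges ?G)"
      proof (cases "v \<in> set xs")
        case True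
        then obtain m where m: "m < 2 * d" "v = xs ! m" using xs(2) by (auto simp: in_set_conv_nth)
        moreover have "ys ! m \<in> S" using S(2) ys(1) m(1) nth_mem[of m ys] by auto
        ultimately show ?thesis using dom[OF m(1)] by auto
      next
        case False
        have "{u, v} \<notin> edge_set d xs" for u
        proof
          assume "{u, v} \<in> edge_set d xs"
          then obtain l where "l < d" "{u, v} = {xs ! l, xs ! (d + l)}" by (auto simp: edge_set_def)
          then have "v = xs ! l \<or> v = xs ! (d + l)" "l < length xs" "d + l < length xs"
            using xs(2) by (auto simp: doubleton_eq_iff)
          then show False using False nth_mem by metis
        qed
        then show ?thesis using S(1) v by (auto simp: dominating_set_def)
      qed
    qed (use S(1) in \<open>auto simp: dominating_set_def\<close>)
    then show "domination_number ?G \<le> k"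
      using domination_number_le_iff[OF fin] S(3) by blast
  qed
qed

text \<open>
  Lists of length \<open>j\<close> stand for sets of at most \<open>j\<close> vertices; without vertices there would be no list of
  positive length.
\<close>

lemma domination_number_le_iff_list:
  assumes G: "simple_graph G" and "verts G \<noteq> {}"
  shows "domination_number G \<le> j \<longleftrightarrow>
    (\<exists>zs. length zs = j \<and> set zs \<subseteq> verts G \<and> (\<forall>v\<in>verts G. \<exists>i<j. zs ! i = v \<or> {zs ! i, v} \<in> edges G))"
    (is "_ \<longleftrightarrow> ?R")
proof -
  have fin: "finite (verts G)" using G by (simp add: simple_graph_def)
  show ?thesis
  proof
    assume "domination_number G \<le> j"
    then obtain S where S: "dominating_set G S" "card S \<le> j"
      using domination_number_le_iff[OF fin] by blast
    have "S \<noteq> {}" "finite S"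
      using S(1) assms(2) fin by (auto simp: dominating_set_def intro: finite_subset)
    then obtain zs where zs: "length zs = j" "set zs = S" using list_of_set S(2) by metis
    have "\<exists>i<j. zs ! i = v \<or> {zs ! i, v} \<in> edges G" if "v \<in> verts G" for v
    proof -
      have "v \<in> S \<or> (\<exists>u\<in>S. {u, v} \<in> edges G)"
        using S(1) that unfolding dominating_set_def by blast
      then have "\<exists>u\<in>S. u = v \<or> {u, v} \<in> edges G" by metis
      then obtain u where "u \<in> S" "u = v \<or> {u, v} \<in> edges G" by blast
      moreover obtain i where "i < j" "zs ! i = u"
        using \<open>u \<in> S\<close> zs by (metis in_set_conv_nth)
      ultimately show ?thesis by blast
    qed
    moreover have "set zs \<subseteq> verts G" using zs S(1) by (auto simp: dominating_set_def)
    ultimately show ?R using zs(1) by blast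
  next
    assume ?R
    then obtain zs where zs: "length zs = j" "set zs \<subseteq> verts G"
      "\<And>v. v \<in> verts G \<Longrightarrow> \<exists>i<j. zs ! i = v \<or> {zs ! i, v} \<in> edges G" by blast
    have "dominating_set G (set zs)"
      unfolding dominating_set_def
    proof (intro conjI ballI)
      fix v assume "v \<in> verts G"
      then obtain i where "i < j" "zs ! i = v \<or> {zs ! i, v} \<in> edges G" using zs(3) by blast
      moreover have "zs ! i \<in> set zs" using zs(1) \<open>i < j\<close> by simp
      ultimately show "v \<in> set zs \<or> (\<exists>u\<in>set zs. {u, v} \<in> edges G)" by blast
    qed (rule zs(2))
    moreover have "card (set zs) \<le> j" using card_length[of zs] zs(1) by simp
    ultimately show "domination_number G \<le> j" using domination_number_le_iff[OF fin] by blast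
  qed
qed

lemma two_neighbours:
  assumes H: "simple_graph H" and deg: "min_degree H \<ge> 2" and h: "h \<in> verts H"
  obtains a b where "a \<noteq> b" "{h, a} \<in> edges H" "{h, b} \<in> edges H" "a \<in> verts H" "b \<in> verts H"
proof -
  have "min_degree H \<le> vertex_degree H h"
    unfolding min_degree_def
  proof (rule Min_le)
    show "finite (vertex_degree H ` verts H)" using H by (simp add: simple_graph_def)
  qed (rule imageI[OF h])
  then have "2 \<le> card {e \<in> edges H. h \<in> e}" using deg by (simp add: vertex_degree_def)
  then obtain T where "T \<subseteq> {e \<in> edges H. h \<in> e}" "card T = 2"
    using obtain_subset_with_card_n by metis
  then obtain e f where ef: "e \<in> edges H" "f \<in> edges H" "h \<in> e" "h \<in> f" "e \<noteq> f"
    unfolding card_2_iff by blast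
  have "\<exists>a. e = {h, a} \<and> a \<in> verts H" if "e \<in> edges H" "h \<in> e" for e
  proof -
    have "card e = 2" "e \<subseteq> verts H" using H that by (auto simp: simple_graph_def)
    then obtain x y where "e = {x, y}" by (auto simp: card_2_iff)
    then show ?thesis using that \<open>e \<subseteq> verts H\<close> by auto
  qed
  from this[OF ef(1,3)] this[OF ef(2,4)]
  obtain a b where "e = {h, a}" "f = {h, b}" "a \<in> verts H" "b \<in> verts H" by blast
  then show ?thesis using that ef by blast
qed

text \<open>
  In an induced copy of \<open>H\<close>, every vertex has two distinct neighbours, but a pendant vertex has only one.
  So the copy lies in \<open>G\<close>.
\<close>

lemma induced_free_add_pendants:
  assumes H: "simple_graph H" "min_degree H \<ge> 2" and free: "induced_free H G"
    and G: "G \<in> graphs" and ys: "set ys \<subseteq> verts G"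
  shows "induced_free H (add_pendants G ys)"
  unfolding induced_free_def
proof
  let ?n = "card (verts G)" and ?G = "add_pendants G ys"
  have V: "v \<in> verts G \<longleftrightarrow> v < ?n" for v by (rule mem_verts_iff[OF G])
  assume "\<exists>S \<subseteq> verts ?G. isomorphic (induced_subgraph ?G S) H"
  then obtain S f where S: "S \<subseteq> verts ?G" and f: "bij_betw f S (verts H)"
    and iso: "\<And>u v. u \<in> S \<Longrightarrow> v \<in> S \<Longrightarrow> {u, v} \<in> edges ?G \<longleftrightarrow> {f u, f v} \<in> edges H"
    by (auto simp: isomorphic_def induced_subgraph_def)
  have S': "S \<subseteq> verts G"
  proof (rule ccontr)
    assume "\<not> S \<subseteq> verts G"
    then obtain v where v: "v \<in> S" "v \<notin> verts G" by blast
    have "v < ?n + length ys" "\<not> v < ?n" using v S V by (auto simp: add_pendants_def)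
    then obtain q where q: "v = ?n + q" "q < length ys"
      by (metis add_less_cancel_left le_Suc_ex not_less)
    have "f v \<in> verts H" using f v(1) by (auto simp: bij_betw_def)
    then obtain a b where ab: "a \<noteq> b" "{f v, a} \<in> edges H" "{f v, b} \<in> edges H" "a \<in> verts H" "b \<in> verts H"
      using two_neighbours[OF H] by blast
    have "f ` S = verts H" using f by (simp add: bij_betw_def)
    then obtain s t where st: "s \<in> S" "t \<in> S" "a = f s" "b = f t" using ab by blast
    have "{v, s} \<in> edges ?G" "{v, t} \<in> edges ?G" using iso v st ab by auto
    then have "s = ys ! q" "t = ys ! q"
      using add_pendants_edges(2)[OF G ys q(2)] q(1) by (auto simp: insert_commute)
    then show False using st ab(1) by simp
  qed
  have "{u, v} \<in> edges ?G \<longleftrightarrow> {u, v} \<in> edges G" if "u \<in> S" "v \<in> S" for u v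
  proof -
    have "u < ?n" "v < ?n" using that S' V by blast+
    then show ?thesis by (rule add_pendants_edges(1)[OF G ys])
  qed
  then have "isomorphic (induced_subgraph G S) H"
    using f iso by (auto simp: isomorphic_def induced_subgraph_def)
  then show False using free S' by (auto simp: induced_free_def)
qed

section \<open>Polynomially bounded functions\<close>

definition poly_bounded :: "(nat \<Rightarrow> nat) \<Rightarrow> bool" where
  "poly_bounded f \<longleftrightarrow> (\<exists>p :: nat poly. \<forall>n. f n \<le> poly p n)"

lemma poly_nat_mono: "x \<le> y \<Longrightarrow> poly (p :: nat poly) x \<le> poly p y"
  by (induction p) (auto intro!: add_mono mult_mono)

lemma poly_bounded_const [intro!, simp]: "poly_bounded (\<lambda>_. c)"
  unfolding poly_bounded_def by (rule exI[of _ "[:c:]"]) simp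

lemma poly_bounded_id [intro!, simp]: "poly_bounded (\<lambda>n. n)"
  unfolding poly_bounded_def by (rule exI[of _ "[:0, 1:]"]) simp

lemma poly_bounded_add [intro!]:
  assumes "poly_bounded f" "poly_bounded g"
  shows "poly_bounded (\<lambda>n. f n + g n)"
proof -
  from assms obtain p q where "\<forall>n. f n \<le> poly p n" "\<forall>n. g n \<le> poly q n"
    unfolding poly_bounded_def by blast
  then show ?thesis
    unfolding poly_bounded_def by (intro exI[of _ "p + q"]) (auto intro: add_mono)
qed

lemma poly_bounded_mult [intro!]:
  assumes "poly_bounded f" "poly_bounded g"
  shows "poly_bounded (\<lambda>n. f n * g n)"
proof -
  from assms obtain p q where "\<forall>n. f n \<le> poly p n" "\<forall>n. g n \<le> poly q n"
    unfolding poly_bounded_def by blast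
  then show ?thesis
    unfolding poly_bounded_def by (intro exI[of _ "p * q"]) (auto intro: mult_mono)
qed

lemma poly_bounded_poly [intro!]:
  assumes "poly_bounded f"
  shows "poly_bounded (\<lambda>n. poly p (f n))"
proof -
  from assms obtain q where "\<forall>n. f n \<le> poly q n"
    unfolding poly_bounded_def by blast
  then show ?thesis
    unfolding poly_bounded_def
    by (intro exI[of _ "pcompose p q"]) (auto simp: poly_pcompose intro: poly_nat_mono)
qed

section \<open>Tape programs\<close>

text \<open>
  Every action may read all tapes, but it changes only those in its first argument. Actions and tests are
  arbitrary functions of the scanned symbols, since the transition function of a machine is arbitrary
  as well.
\<close>

datatype 'v cmd =
    Act "'v set" "('v \<Rightarrow> nat) \<Rightarrow> 'v \<Rightarrow> nat \<times> move"
  | Seq "'v cmd" "'v cmd"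
  | If "('v \<Rightarrow> nat) \<Rightarrow> bool" "'v cmd" "'v cmd"
  | While "('v \<Rightarrow> nat) \<Rightarrow> bool" "'v cmd"

definition scan :: "('v \<Rightarrow> tape) \<Rightarrow> 'v \<Rightarrow> nat" where
  "scan T v = read_tape (T v)"

definition act_on :: "'v set \<Rightarrow> (('v \<Rightarrow> nat) \<Rightarrow> 'v \<Rightarrow> nat \<times> move) \<Rightarrow> ('v \<Rightarrow> tape) \<Rightarrow> 'v \<Rightarrow> tape" where
  "act_on A f T v = (if v \<in> A then act_tape (f (scan T) v) (T v) else T v)"

text \<open>
  The second argument from the right counts the steps of the machine built below, which spends one step on each
  node of the program that it passes.
\<close>

inductive exec :: "'v cmd \<Rightarrow> ('v \<Rightarrow> tape) \<Rightarrow> nat \<Rightarrow> ('v \<Rightarrow> tape) \<Rightarrow> bool" where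
  exec_Act: "exec (Act A f) T 1 (act_on A f T)"
| exec_Seq: "exec c T t T' \<Longrightarrow> exec d T' u T'' \<Longrightarrow> exec (Seq c d) T (Suc (t + u)) T''"
| exec_If: "exec (if b (scan T) then c else d) T t T' \<Longrightarrow> exec (If b c d) T (Suc t) T'"
| exec_While_False: "\<not> b (scan T) \<Longrightarrow> exec (While b c) T 1 T"
| exec_While_True: "b (scan T) \<Longrightarrow> exec c T t T' \<Longrightarrow> exec (While b c) T' u T''
    \<Longrightarrow> exec (While b c) T (Suc (t + u)) T''"

fun wf_cmd :: "'v set \<Rightarrow> nat \<Rightarrow> 'v cmd \<Rightarrow> bool" where
  "wf_cmd V S (Act A f) \<longleftrightarrow> A \<subseteq> V \<and> (\<forall>s. (\<forall>v. s v < S) \<longrightarrow> (\<forall>v\<in>A. fst (f s v) < S))"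
| "wf_cmd V S (Seq c d) \<longleftrightarrow> wf_cmd V S c \<and> wf_cmd V S d"
| "wf_cmd V S (If b c d) \<longleftrightarrow> wf_cmd V S c \<and> wf_cmd V S d"
| "wf_cmd V S (While b c) \<longleftrightarrow> wf_cmd V S c"

text \<open>
  The control state is the stack of commands that remain to be executed. Only its top decides on the
  next step, and no labels or jump addresses are needed.
\<close>

fun next_stack :: "('v \<Rightarrow> nat) \<Rightarrow> 'v cmd list \<Rightarrow> 'v cmd list" where
  "next_stack s [] = []"
| "next_stack s (Act A f # cs) = cs"
| "next_stack s (Seq c d # cs) = c # d # cs"
| "next_stack s (If b c d # cs) = (if b s then c else d) # cs"
| "next_stack s (While b c # cs) = (if b s then c # While b c # cs else cs)"

fun stack_act :: "'v cmd list \<Rightarrow> ('v \<Rightarrow> nat) \<Rightarrow> 'v \<Rightarrow> nat \<times> move" where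
  "stack_act (Act A f # cs) s v = (if v \<in> A then f s v else (s v, Stay))"
| "stack_act _ s v = (s v, Stay)"

definition stack_step :: "'v cmd list \<times> ('v \<Rightarrow> tape) \<Rightarrow> 'v cmd list \<times> ('v \<Rightarrow> tape)" where
  "stack_step = (\<lambda>(cs, T). (next_stack (scan T) cs, \<lambda>v. act_tape (stack_act cs (scan T) v) (T v)))"

lemma act_tape_same: "act_tape (read_tape \<tau>, m) \<tau> = (fst \<tau>, move_head m (snd \<tau>))"
  by (cases \<tau>) auto

lemma act_tape_scan: "act_tape (scan T v, m) (T v) = (fst (T v), move_head m (snd (T v)))"
  by (simp add: scan_def act_tape_same)

lemma act_tape_Stay: "act_tape (scan T v, Stay) (T v) = T v"
  by (simp add: act_tape_scan)

lemma funpow_Suc_add: "f x = y \<Longrightarrow> (f ^^ Suc (t + u)) x = (f ^^ u) ((f ^^ t) y)"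
  using funpow_add[of u t f] by (simp add: funpow_Suc_right add.commute del: funpow.simps)

lemma exec_stack_step:
  "exec c T t T' \<Longrightarrow> (stack_step ^^ t) (c # cs, T) = (cs, T')"
proof (induction arbitrary: cs rule: exec.induct)
  case (exec_Act A f T)
  show ?case
    by (auto simp: stack_step_def act_on_def fun_eq_iff act_tape_scan)
next
  case (exec_Seq c T t T' d u T'')
  have "stack_step (Seq c d # cs, T) = (c # d # cs, T)"
    by (simp add: stack_step_def act_tape_Stay)
  then have "(stack_step ^^ Suc (t + u)) (Seq c d # cs, T) = (stack_step ^^ u) ((stack_step ^^ t) (c # d # cs, T))"
    by (rule funpow_Suc_add)
  then show ?case using exec_Seq.IH by simp
next
  case (exec_If b T c d t T')
  have "stack_step (If b c d # cs, T) = ((if b (scan T) then c else d) # cs, T)"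
    by (simp add: stack_step_def act_tape_Stay)
  then show ?case using exec_If.IH
    by (simp add: funpow_Suc_right del: funpow.simps)
next
  case (exec_While_False b T c)
  then show ?case by (simp add: stack_step_def act_tape_Stay)
next
  case (exec_While_True b T c t T' u T'')
  have "stack_step (While b c # cs, T) = (c # While b c # cs, T)"
    using exec_While_True.hyps by (simp add: stack_step_def act_tape_Stay)
  then have "(stack_step ^^ Suc (t + u)) (While b c # cs, T) = (stack_step ^^ u) ((stack_step ^^ t) (c # While b c # cs, T))"
    by (rule funpow_Suc_add)
  then show ?case using exec_While_True.IH by simp
qed

text \<open>
  While a command is executed, the stack consists of a part belonging to this command and of the
  unchanged rest. The possible first parts form a finite set, which is what makes stacks usable as states.
\<close>

fun reach :: "'v cmd \<Rightarrow> 'v cmd list set" where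
  "reach (Act A f) = {[Act A f]}"
| "reach (Seq c d) = insert [Seq c d] ((\<lambda>cs. cs @ [d]) ` reach c \<union> reach d)"
| "reach (If b c d) = insert [If b c d] (reach c \<union> reach d)"
| "reach (While b c) = insert [While b c] ((\<lambda>cs. cs @ [While b c]) ` reach c)"

lemma finite_reach: "finite (reach c)"
  by (induction c) auto

lemma start_in_reach: "[c] \<in> reach c"
  by (cases c) auto

lemma next_stack_append: "cs \<noteq> [] \<Longrightarrow> next_stack s (cs @ ds) = next_stack s cs @ ds"
  by (cases "(s, cs)" rule: next_stack.cases) auto

lemma reach_nonempty: "\<forall>cs\<in>reach c. cs \<noteq> []"
  by (induction c) (simp_all add: ball_Un)

lemma next_stack_in_reach: "cs \<in> reach c \<Longrightarrow> next_stack s cs \<in> insert [] (reach c)"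
proof (induction c arbitrary: cs)
  case (Seq c d)
  have snoc: "ds @ [d] \<in> reach (Seq c d)" if "ds \<in> insert [] (reach c)" for ds
    using that start_in_reach[of d] by auto
  from Seq.prems consider "cs = [Seq c d]" | ds where "ds \<in> reach c" "cs = ds @ [d]" | "cs \<in> reach d"
    unfolding reach.simps by blast
  then show ?case
  proof cases
    case 1
    then have "next_stack s cs = [c] @ [d]" by simp
    then show ?thesis using snoc[of "[c]"] start_in_reach[of c] by simp
  next
    case 2
    have "next_stack s cs = next_stack s ds @ [d]"
      using 2 bspec[OF reach_nonempty[of c] 2(1)] next_stack_append by blast
    then show ?thesis using snoc[OF Seq.IH(1)[OF 2(1)]] by simp
  next
    case 3
    then show ?thesis using Seq.IH(2)[OF 3] unfolding reach.simps by blast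
  qed
next
  case (If b c d)
  then show ?case using start_in_reach[of c] start_in_reach[of d]
    unfolding reach.simps by (elim insertE UnE) (auto split: if_splits)
next
  case (While b c)
  have snoc: "ds @ [While b c] \<in> reach (While b c)" if "ds \<in> insert [] (reach c)" for ds
    using that by auto
  from While.prems consider "cs = [While b c]" | ds where "ds \<in> reach c" "cs = ds @ [While b c]"
    unfolding reach.simps by blast
  then show ?case
  proof cases
    case 1
    then have "next_stack s cs = (if b s then [c] @ [While b c] else [])" by simp
    then show ?thesis using snoc[of "[c]"] start_in_reach[of c] by simp
  next
    case 2
    have "next_stack s cs = next_stack s ds @ [While b c]"
      using 2 bspec[OF reach_nonempty[of c] 2(1)] next_stack_append by blast
    then show ?thesis using snoc[OF While.IH[OF 2(1)]] by simp
  qed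
qed auto

text \<open>
  Stated with \<open>list_all\<close>, the induction hypothesis is a usable rewrite rule; quantifying over the elements
  of the stack would leave the stack undetermined in its condition.
\<close>

lemma reach_wf:
  assumes "wf_cmd V S c"
  shows "\<forall>cs\<in>reach c. list_all (wf_cmd V S) cs"
  using assms by (induction c) (simp_all add: ball_Un)

lemma stack_act_bounded:
  assumes "list_all (wf_cmd V S) cs" "\<forall>v. s v < S"
  shows "fst (stack_act cs s v) < S"
  using assms by (cases "(cs, s, v)" rule: stack_act.cases) auto

lemma stack_act_outside:
  assumes "list_all (wf_cmd V S) cs" "v \<notin> V"
  shows "stack_act cs s v = (s v, Stay)"
  using assms by (cases "(cs, s, v)" rule: stack_act.cases) auto

definition lookup :: "'v list \<Rightarrow> nat list \<Rightarrow> 'v \<Rightarrow> nat" where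
  "lookup vs xs v = (case map_of (zip vs xs) v of None \<Rightarrow> 0 | Some x \<Rightarrow> x)"

lemma lookup_map: "lookup vs (map g vs) v = (if v \<in> set vs then g v else 0)"
  by (simp add: lookup_def map_of_zip_map)

lemma lookup_bounded:
  assumes "\<forall>x\<in>set xs. x < S" "0 < S"
  shows "lookup vs xs v < S"
  using assms by (auto simp: lookup_def split: option.splits dest!: map_of_SomeD set_zip_rightD)

text \<open>
  The states are codes of the stacks, together with two states \<open>N\<close> and \<open>N + 1\<close> for acceptance and rejection.
  From the empty stack, one more step reads the result from the tape \<open>fl\<close>; this is the extra step in the
  time bound.
\<close>

lemma program_machine:
  fixes c :: "'v cmd" and inp fl :: 'v
  assumes wf: "wf_cmd V S c" and "finite V" and "inp \<in> V" "fl \<in> V" and S: "S \<ge> 3"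
  obtains M where "wf_tm M"
    "\<And>w t T b. exec c ((\<lambda>_. blank_tape)(inp := input_tape w)) t T \<Longrightarrow> read_tape (T fl) = (if b then 1 else 0) \<Longrightarrow>
       if b then accepts_within M w (Suc t) else rejects_within M w (Suc t)"
proof -
  define Q where "Q = insert [] (reach c)"
  have "finite Q" by (simp add: Q_def finite_reach)
  then obtain code where code: "bij_betw code Q {0..<card Q}"
    using ex_bij_betw_finite_nat by blast
  define N where "N = card Q"
  obtain vs' where vs': "set vs' = V - {inp}" "distinct vs'"
    using finite_distinct_list \<open>finite V\<close> by blast
  define vs where "vs = inp # vs'"
  have vs: "set vs = V" "distinct vs" "vs \<noteq> []"
    using vs' \<open>inp \<in> V\<close> by (auto simp: vs_def)
  define dec where "dec = the_inv_into Q code"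
  define dl where "dl = (\<lambda>q xs. let cs = dec q; s = lookup vs xs in
     (if N \<le> q then 0 else if cs = [] then (if s fl = 1 then N else Suc N) else code (next_stack s cs),
      if N \<le> q then map (\<lambda>_. (0, Stay)) vs else map (stack_act cs s) vs))"
  define M where "M = \<lparr>num_tapes = length vs, num_symbols = S, num_states = N + 2,
     start_state = code [c], accept_state = N, reject_state = Suc N, delta = dl\<rparr>"
  have codeQ: "code cs < N" "dec (code cs) = cs" if "cs \<in> Q" for cs
    using code that unfolding bij_betw_def N_def dec_def by (auto simp: the_inv_into_f_f)
  have decQ: "dec q \<in> Q" if "q < N" for q
    using code that unfolding bij_betw_def N_def dec_def
    by (metis atLeastLessThan_iff dec_def le0 the_inv_into_into subset_refl)
  have nextQ: "next_stack s cs \<in> Q" if "cs \<in> Q" for s cs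
    using that next_stack_in_reach[of cs c s] by (auto simp: Q_def)
  have wfQ: "list_all (wf_cmd V S) cs" if "cs \<in> Q" for cs
    using that reach_wf[OF wf] by (auto simp: Q_def)
  have startQ: "[c] \<in> Q" by (simp add: Q_def start_in_reach)
  have "wf_tm M"
    unfolding wf_tm_def
  proof (intro conjI allI impI)
    fix q xs assume q: "q < num_states M"
      and xs: "length xs = num_tapes M \<and> (\<forall>x\<in>set xs. x < num_symbols M)"
    have lb: "\<forall>v. lookup vs xs v < S"
      using lookup_bounded[of xs S vs] xs S by (auto simp: M_def)
    show "case delta M q xs of (q', acts) \<Rightarrow>
           q' < num_states M \<and> length acts = num_tapes M \<and>
           (\<forall>(s, m)\<in>set acts. s < num_symbols M)"
    proof (cases "N \<le> q")
      case True
      then show ?thesis using S by (auto simp: M_def dl_def Let_def)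
    next
      case False
      have "fst (stack_act (dec q) (lookup vs xs) v) < S" for v
        using stack_act_bounded[OF wfQ[OF decQ] lb] False by simp
      moreover have "code (next_stack (lookup vs xs) (dec q)) < N"
        using codeQ(1)[OF nextQ[OF decQ]] False by simp
      ultimately show ?thesis using False
        by (auto simp: M_def dl_def Let_def) (metis fst_conv)+
    qed
  qed (use S vs codeQ(1)[OF startQ] in \<open>auto simp: M_def Suc_le_eq\<close>)
  moreover
  define cfg :: "'v cmd list \<times> ('v \<Rightarrow> tape) \<Rightarrow> config" where "cfg = (\<lambda>(cs, T). (code cs, map T vs))"
  have step: "tm_step M (cfg (cs, T)) = cfg (stack_step (cs, T))"
       "\<forall>v. v \<notin> V \<longrightarrow> snd (stack_step (cs, T)) v = blank_tape" "fst (stack_step (cs, T)) \<in> Q"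
    if "cs \<in> Q" "\<forall>v. v \<notin> V \<longrightarrow> T v = blank_tape" "cs \<noteq> []" for cs T
  proof -
    have sc: "lookup vs (map read_tape (map T vs)) = scan T"
      using that vs lookup_map[of vs "\<lambda>v. read_tape (T v)"]
      by (auto simp: fun_eq_iff scan_def comp_def blank_tape_def)
    show "tm_step M (cfg (cs, T)) = cfg (stack_step (cs, T))"
      using codeQ[OF that(1)] sc that
      by (auto simp: cfg_def M_def dl_def Let_def stack_step_def zip_map_map zip_same_conv_map)
    show "\<forall>v. v \<notin> V \<longrightarrow> snd (stack_step (cs, T)) v = blank_tape"
    proof (intro allI impI)
      fix v assume v: "v \<notin> V"
      have "snd (stack_step (cs, T)) v = T v"
        unfolding stack_step_def
        by (simp only: prod.case snd_conv stack_act_outside[OF wfQ[OF that(1)] v] act_tape_Stay)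
      then show "snd (stack_step (cs, T)) v = blank_tape" using that(2) v by simp
    qed
    show "fst (stack_step (cs, T)) \<in> Q"
      using nextQ[OF that(1)] by (simp add: stack_step_def act_tape_Stay)
  qed
  have "if b then accepts_within M w (Suc t) else rejects_within M w (Suc t)"
    if ex: "exec c ((\<lambda>_. blank_tape)(inp := input_tape w)) t T" and fl: "read_tape (T fl) = (if b then 1 else 0)"
    for w t T b
  proof -
    define T0 where "T0 = (\<lambda>_. blank_tape)(inp := input_tape w)"
    define run where "run = (\<lambda>i. (stack_step ^^ i) ([c], T0))"
    have run_Suc: "run (Suc i) = stack_step (run i)" for i
      by (simp add: run_def)
    have runt: "run t = ([], T)"
      using exec_stack_step[OF ex] by (simp add: run_def T0_def)
    have "map T0 vs' = map (\<lambda>_. blank_tape) vs'"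
      using vs'(1) by (intro map_cong) (auto simp: T0_def)
    then have "map T0 vs = input_tape w # replicate (num_tapes M - 1) blank_tape"
      by (simp add: vs_def M_def map_replicate_const) (simp add: T0_def)
    moreover have "start_state M = code [c]" by (simp add: M_def)
    ultimately have init: "initial_config M w = cfg (run 0)"
      by (simp add: initial_config_def cfg_def run_def)
    define t' where "t' = (LEAST i. fst (run i) = [])"
    have ended: "fst (run t) = []" using runt by simp
    have t': "t' \<le> t" "fst (run t') = []"
      unfolding t'_def by (rule Least_le[where P = "\<lambda>i. fst (run i) = []", OF ended], rule LeastI[where P = "\<lambda>i. fst (run i) = []", OF ended])
    have before: "fst (run i) \<noteq> []" if "i < t'" for i
      using not_less_Least[of i "\<lambda>i. fst (run i) = []"] that by (simp add: t'_def)
    \<comment> \<open>The machine follows the stacks only until they are empty; \<open>t'\<close> is the first such time, and later configurations are equal.\<close>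
    have tT: "run t = run t'"
    proof -
      have "run (t' + j) = run t'" for j
      proof (induction j)
        case (Suc j)
        obtain T' where "run t' = ([], T')" using t'(2) by (metis prod.collapse)
        then show ?case using Suc by (simp add: run_Suc stack_step_def act_tape_Stay)
      qed simp
      then show ?thesis using t'(1) by (metis le_add_diff_inverse)
    qed
    have sim: "(tm_step M ^^ i) (initial_config M w) = cfg (run i) \<and> fst (run i) \<in> Q \<and>
        (\<forall>v. v \<notin> V \<longrightarrow> snd (run i) v = blank_tape)" if "i \<le> t'" for i
      using that
    proof (induction i)
      case 0
      then show ?case using init startQ \<open>inp \<in> V\<close> by (auto simp: run_def T0_def)
    next
      case (Suc i)
      then have "fst (run i) \<noteq> []" using before by simp
      then show ?case using Suc step[of "fst (run i)" "snd (run i)"] by (simp add: run_Suc)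
    qed
    have fin: "(tm_step M ^^ t') (initial_config M w) = (code [], map T vs)"
    proof -
      have "run t' = ([], T)" using tT runt by simp
      then show ?thesis using sim[of t'] by (simp add: cfg_def)
    qed
    have lk: "lookup vs (map read_tape (map T vs)) fl = (if b then 1 else 0)"
      using fl vs \<open>fl \<in> V\<close> lookup_map[of vs "\<lambda>v. read_tape (T v)" fl] by (simp add: comp_def)
    have halt: "fst ((tm_step M ^^ Suc t') (initial_config M w)) = (if b then N else Suc N)"
      using fin lk codeQ[of "[]"] by (auto simp: M_def dl_def Let_def Q_def)
    have "fst ((tm_step M ^^ (Suc t' + j)) (initial_config M w)) = (if b then N else Suc N)" for j
    proof (induction j)
      case 0 then show ?case using halt by simp
    next
      case (Suc j)
      obtain q ts where "(tm_step M ^^ (Suc t' + j)) (initial_config M w) = (q, ts)"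
        by (metis prod.exhaust)
      then show ?case using Suc by (auto simp: M_def)
    qed
    from this[of "t - t'"] t'(1) show ?thesis
      by (auto simp: accepts_within_def rejects_within_def M_def)
  qed
  ultimately show ?thesis using that by blast
qed

definition runs :: "'v cmd \<Rightarrow> ('v \<Rightarrow> tape) \<Rightarrow> nat \<Rightarrow> ('v \<Rightarrow> tape) \<Rightarrow> bool" where
  "runs c T t T' \<longleftrightarrow> (\<exists>u\<le>t. exec c T u T')"

lemma runs_mono: "runs c T t T' \<Longrightarrow> t \<le> u \<Longrightarrow> runs c T u T'"
  by (auto simp: runs_def intro: order_trans)

lemma runs_Act: "act_on A f T = T' \<Longrightarrow> runs (Act A f) T 1 T'"
  unfolding runs_def using exec_Act by blast

lemma runs_Seq: "runs c T t T' \<Longrightarrow> runs d T' u T'' \<Longrightarrow> runs (Seq c d) T (t + u + 1) T''"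
  unfolding runs_def
proof (elim exE conjE)
  fix r s
  assume "r \<le> t" "exec c T r T'" "s \<le> u" "exec d T' s T''"
  then show "\<exists>r\<le>t + u + 1. exec (Seq c d) T r T''"
    by (intro exI[of _ "Suc (r + s)"]) (simp add: exec_Seq)
qed

lemma runs_If: "runs (if b (scan T) then c else d) T t T' \<Longrightarrow> runs (If b c d) T (t + 1) T'"
  by (fastforce simp: runs_def intro: exec_If)

lemma runs_While:
  assumes "\<And>i. i < k \<Longrightarrow> b (scan (T i))" "\<And>i. i < k \<Longrightarrow> runs c (T i) t (T (Suc i))" "\<not> b (scan (T k))"
  shows "runs (While b c) (T 0) (k * (t + 1) + 1) (T k)"
  using assms
proof (induction k arbitrary: T)
  case 0
  then show ?case by (auto simp: runs_def intro!: exec_While_False exI[of _ "1::nat"])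
next
  case (Suc k)
  have "runs (While b c) (T (Suc 0)) (k * (t + 1) + 1) (T (Suc k))"
    using Suc.IH[of "\<lambda>i. T (Suc i)"] Suc.prems by simp
  then obtain u where u: "u \<le> k * (t + 1) + 1" "exec (While b c) (T (Suc 0)) u (T (Suc k))"
    unfolding runs_def by blast
  obtain r where "r \<le> t" "exec c (T 0) r (T (Suc 0))"
    using Suc.prems(2)[of 0] unfolding runs_def by blast
  then have "exec (While b c) (T 0) (Suc (r + u)) (T (Suc k))"
    using exec_While_True[of b "T 0" c r "T (Suc 0)" u "T (Suc k)"] Suc.prems(1)[of 0] u by auto
  moreover have "Suc (r + u) \<le> Suc k * (t + 1) + 1"
    using u(1) \<open>r \<le> t\<close> by simp
  ultimately show ?case unfolding runs_def by blast
qed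

section \<open>Calling a Turing machine and undoing its computation\<close>

text \<open>
  \<open>Work 0, Work 1, ...\<close> are the tapes of the called machine and \<open>State\<close> holds its state; the logs
  record its past states and scanned symbols. \<open>Var i\<close> holds the \<open>i\<close>-th vertex variable, \<open>Flag\<close> the
  truth value computed last.
\<close>

datatype name = In | Flag | Scratch | State | State_Log | Var nat | Work nat | Log nat

definition cell :: "nat \<Rightarrow> tape" where
  "cell x = ((\<lambda>_. 0)(0 := x), 0)"

lemma cell_0: "cell 0 = blank_tape"
  by (simp add: cell_def blank_tape_def fun_eq_iff)

lemma act_tape_cell [simp]: "act_tape (x, Stay) (cell y) = cell x"
  by (simp add: cell_def)

lemma read_cell [simp]: "read_tape (cell x) = x"
  by (simp add: cell_def)

lemma runs_move:
  assumes "\<And>v. T' v = (if v \<in> A then (fst (T v), move_head (g v) (snd (T v))) else T v)"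
  shows "runs (Act A (\<lambda>s v. (s v, g v))) T 1 T'"
  by (rule runs_Act) (auto simp: act_on_def fun_eq_iff act_tape_scan assms)

definition shift :: "'v set \<Rightarrow> move \<Rightarrow> 'v cmd" where
  "shift A m = Act A (\<lambda>s v. (s v, m))"

lemma wf_shift [simp]: "wf_cmd V S (shift A m) \<longleftrightarrow> A \<subseteq> V"
  by (auto simp: shift_def)

lemma runs_shift:
  assumes "\<And>v. T' v = (if v \<in> A then (fst (T v), move_head m (snd (T v))) else T v)"
  shows "runs (shift A m) T 1 T'"
  unfolding shift_def by (rule runs_move) (rule assms)

definition put :: "'v \<Rightarrow> (('v \<Rightarrow> nat) \<Rightarrow> nat) \<Rightarrow> 'v cmd" where
  "put u f = Act {u} (\<lambda>s v. (f s, Stay))"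

lemma wf_put: "wf_cmd V S (put u f) \<longleftrightarrow> u \<in> V \<and> (\<forall>s. (\<forall>v. s v < S) \<longrightarrow> f s < S)"
  by (auto simp: put_def)

lemma runs_put: "T u = cell x \<Longrightarrow> runs (put u f) T 1 (T(u := cell (f (scan T))))"
  unfolding put_def by (rule runs_Act) (auto simp: act_on_def fun_eq_iff)

lemma runs_put': "T u = cell x \<Longrightarrow> f (scan T) = y \<Longrightarrow> T' = T(u := cell y) \<Longrightarrow> runs (put u f) T 1 T'"
  using runs_put by metis

fun opposite :: "move \<Rightarrow> move" where
  "opposite Move_Left = Move_Right"
| "opposite Stay = Stay"
| "opposite Move_Right = Move_Left"

lemma move_head_opposite [simp]: "move_head (opposite m) (move_head m h) = h"
  by (cases m) auto

text \<open>
  \<open>M\<close> is the machine to be called, and \<open>R\<close> is the number of vertex variables.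
\<close>

locale calling =
  fixes M :: tm and R :: nat
  assumes wf_M: "wf_tm M"
begin

abbreviation "K \<equiv> num_tapes M"

definition names :: "name set" where
  "names = {In, Flag, Scratch, State, State_Log} \<union> Var ` {..<R} \<union> Work ` {..<K} \<union> Log ` {..<K}"

text \<open>
  This leaves room for the states of \<open>M\<close>, which are stored as symbols, shifted by one because \<open>0\<close> is the
  blank.
\<close>

definition num_syms :: nat where
  "num_syms = num_symbols M + num_states M + 3"

abbreviation "wfc \<equiv> wf_cmd names num_syms"

lemma K_pos: "0 < K"
  using wf_M by (auto simp: wf_tm_def)

lemma names_simps [simp]:
  "In \<in> names" "Flag \<in> names" "Scratch \<in> names" "State \<in> names" "State_Log \<in> names"
  "Var i \<in> names \<longleftrightarrow> i < R" "Work i \<in> names \<longleftrightarrow> i < K" "Log i \<in> names \<longleftrightarrow> i < K"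
  by (auto simp: names_def)

lemma finite_names: "finite names"
  by (simp add: names_def)

definition config_at :: "bool list \<Rightarrow> nat \<Rightarrow> config" where
  "config_at w t = (tm_step M ^^ t) (initial_config M w)"

definition state_at :: "bool list \<Rightarrow> nat \<Rightarrow> nat" where
  "state_at w t = fst (config_at w t)"

definition tape_at :: "bool list \<Rightarrow> nat \<Rightarrow> nat \<Rightarrow> tape" where
  "tape_at w t i = snd (config_at w t) ! i"

definition action_at :: "bool list \<Rightarrow> nat \<Rightarrow> nat \<times> (nat \<times> move) list" where
  "action_at w t = delta M (state_at w t) (map (\<lambda>i. read_tape (tape_at w t i)) [0..<K])"

definition halted :: "nat \<Rightarrow> bool" where
  "halted q \<longleftrightarrow> q = accept_state M \<or> q = reject_state M"

text \<open>
  Well-formedness of \<open>M\<close> restricts \<open>delta M\<close> only on arguments in range, so this invariant is needed to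
  know anything about the actions in a run.
\<close>

lemma config_at_bounds:
  "state_at w t < num_states M \<and> length (snd (config_at w t)) = K \<and>
   (\<forall>i<K. \<forall>c. fst (tape_at w t i) c < num_symbols M)"
proof (induction t)
  case 0
  have "fst ((input_tape w # replicate (K - 1) blank_tape) ! i) c < num_symbols M" if "i < K" for i c
    using that wf_M
    by (cases i) (auto simp: input_tape_def blank_tape_def wf_tm_def)
  then show ?case
    using K_pos wf_M by (auto simp: state_at_def tape_at_def config_at_def initial_config_def wf_tm_def)
next
  case (Suc t)
  obtain q ts where c: "config_at w t = (q, ts)" by fastforce
  have len: "length ts = K" and q: "q < num_states M"
    and sy: "\<forall>i<K. \<forall>c. fst (ts ! i) c < num_symbols M"
    using Suc.IH by (auto simp: c state_at_def tape_at_def)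
  have rd: "\<forall>x\<in>set (map read_tape ts). x < num_symbols M"
    using sy len by (auto simp: in_set_conv_nth) (metis prod.collapse read_tape.simps)
  obtain q' acts where d: "delta M q (map read_tape ts) = (q', acts)" by fastforce
  have d': "q' < num_states M" "length acts = K" "\<forall>(s, m)\<in>set acts. s < num_symbols M"
    using wf_M q rd len d unfolding wf_tm_def by (metis (mono_tags, lifting) case_prod_conv length_map)+
  have "fst (act_tape (acts ! i) (ts ! i)) c < num_symbols M" if "i < K" for i c
  proof -
    obtain s m where a: "acts ! i = (s, m)" by fastforce
    have "s < num_symbols M" using d'(2,3) that nth_mem[of i acts] a by fastforce
    then show ?thesis using sy that a by (cases "ts ! i") auto
  qed
  then show ?case
    using c d d' len q sy
    by (auto simp: state_at_def tape_at_def config_at_def)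
qed

lemma state_at_less: "state_at w t < num_states M"
  using config_at_bounds by blast

lemma tape_at_less: "i < K \<Longrightarrow> read_tape (tape_at w t i) < num_symbols M"
  using config_at_bounds[of w t] by (cases "tape_at w t i") (metis fst_conv read_tape.simps)

lemma action_at_bounds:
  "fst (action_at w t) < num_states M" "length (snd (action_at w t)) = K"
  "i < K \<Longrightarrow> fst (snd (action_at w t) ! i) < num_symbols M"
proof -
  have "case action_at w t of (q', acts) \<Rightarrow> q' < num_states M \<and> length acts = K \<and>
           (\<forall>(s, m)\<in>set acts. s < num_symbols M)"
    unfolding action_at_def
    using wf_M state_at_less[of w t] tape_at_less[of _ w t] by (auto simp: wf_tm_def)
  then show "fst (action_at w t) < num_states M" "length (snd (action_at w t)) = K"
    and "i < K \<Longrightarrow> fst (snd (action_at w t) ! i) < num_symbols M"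
    by (auto simp: split_beta)
qed

lemma at_Suc:
  assumes "\<not> halted (state_at w t)"
  shows "state_at w (Suc t) = fst (action_at w t)"
    and "i < K \<Longrightarrow> tape_at w (Suc t) i = act_tape (snd (action_at w t) ! i) (tape_at w t i)"
proof -
  obtain q ts where c: "config_at w t = (q, ts)" by fastforce
  have len: "length ts = K"
    using config_at_bounds[of w t] by (simp add: c)
  have m: "map (\<lambda>i. read_tape (tape_at w t i)) [0..<K] = map read_tape ts"
    using len by (intro nth_equalityI) (auto simp: c tape_at_def)
  have "config_at w (Suc t) = tm_step M (config_at w t)"
    by (simp add: config_at_def)
  also have "\<dots> = (fst (action_at w t), map2 act_tape (snd (action_at w t)) ts)"
    using assms m by (simp add: c state_at_def halted_def action_at_def split_beta)
  finally have s: "config_at w (Suc t) = (fst (action_at w t), map2 act_tape (snd (action_at w t)) ts)" .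
  then show "state_at w (Suc t) = fst (action_at w t)"
    by (simp add: state_at_def)
  show "i < K \<Longrightarrow> tape_at w (Suc t) i = act_tape (snd (action_at w t) ! i) (tape_at w t i)"
    using s len action_at_bounds(2)[of w t] by (simp add: tape_at_def c)
qed

definition decide_step :: "nat \<Rightarrow> (nat \<Rightarrow> nat) \<Rightarrow> nat \<times> (nat \<times> move) list" where
  "decide_step x s = delta M (x - 1) (map s [0..<K])"

text \<open>
  One step of \<open>M\<close> together with its logging. The minimum changes nothing in a run of \<open>M\<close>; it
  keeps the written symbols in range when the scanned symbols come from no run, where \<open>delta M\<close> may
  return anything.
\<close>

definition sim_step :: "name cmd" where
  "sim_step = Act ({State, State_Log} \<union> Work ` {..<K} \<union> Log ` {..<K}) (\<lambda>s v.
     let a = decide_step (s State) (\<lambda>i. s (Work i)) in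
     case v of
       State \<Rightarrow> (min (num_syms - 1) (Suc (fst a)), Stay)
     | State_Log \<Rightarrow> (s State, Move_Right)
     | Work i \<Rightarrow> (min (num_syms - 1) (fst (snd a ! i)), snd (snd a ! i))
     | Log i \<Rightarrow> (s (Work i), Move_Right)
     | _ \<Rightarrow> (s v, Stay))"

text \<open>
  A logged state and the logged symbols determine the action taken, hence the moves to be reversed. A
  machine writes before it moves, so undoing takes two actions: first back to the
  cell, then restoring its symbol.
\<close>

definition undo_move :: "name cmd" where
  "undo_move = Act (Work ` {..<K}) (\<lambda>s v.
     let a = decide_step (s State_Log) (\<lambda>i. s (Log i)) in
     case v of Work i \<Rightarrow> (s v, opposite (snd (snd a ! i))) | _ \<Rightarrow> (s v, Stay))"

definition undo_write :: "name cmd" where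
  "undo_write = Act ({State, State_Log} \<union> Work ` {..<K} \<union> Log ` {..<K}) (\<lambda>s v.
     case v of
       State \<Rightarrow> (s State_Log, Stay)
     | State_Log \<Rightarrow> (0, Move_Left)
     | Work i \<Rightarrow> (s (Log i), Stay)
     | Log i \<Rightarrow> (0, Move_Left)
     | _ \<Rightarrow> (s v, Stay))"

definition "logs = {State_Log} \<union> Log ` {..<K}"

text \<open>
  After the run the contents of the work tapes are arbitrary, so the tapes cannot simply be cleared
  without knowing how far the heads went. Undoing the run step by step restores the input and the blanks
  with all heads in place, at the cost of a constant factor in time.
\<close>

definition call :: "name cmd" where
  "call =
     Seq (put State (\<lambda>_. Suc (start_state M)))
    (Seq (While (\<lambda>s. \<not> halted (s State - 1)) sim_step)
    (Seq (put Flag (\<lambda>s. if s State - 1 = accept_state M then 1 else 0))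
    (Seq (shift logs Move_Left)
    (Seq (While (\<lambda>s. s State_Log \<noteq> 0) (Seq undo_move undo_write))
    (Seq (shift logs Move_Right)
         (put State (\<lambda>_. 0)))))))"

lemma wf_call: "wfc call"
proof -
  have "start_state M < num_states M" using wf_M by (simp add: wf_tm_def)
  then show ?thesis
    by (auto simp: call_def wf_put sim_step_def undo_move_def undo_write_def logs_def num_syms_def Let_def)
qed

text \<open>
  The tapes when \<open>M\<close> has made \<open>t\<close> steps and the heads of the logs are at cell \<open>h\<close>. Going forward, \<open>h = t\<close>,
  the first free cell; going backward, \<open>h = t - 1\<close>, the last entry.
\<close>

definition sim :: "(name \<Rightarrow> tape) \<Rightarrow> bool list \<Rightarrow> nat \<Rightarrow> int \<Rightarrow> name \<Rightarrow> tape" where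
  "sim T w t h v = (case v of
       State \<Rightarrow> cell (Suc (state_at w t))
     | State_Log \<Rightarrow> (\<lambda>c. if 0 \<le> c \<and> c < int t then Suc (state_at w (nat c)) else 0, h)
     | Work i \<Rightarrow> if i < K then tape_at w t i else T v
     | Log i \<Rightarrow> if i < K then (\<lambda>c. if 0 \<le> c \<and> c < int t then read_tape (tape_at w (nat c) i) else 0, h) else T v
     | _ \<Rightarrow> T v)"

lemma runs_sim_step:
  assumes nh: "\<not> halted (state_at w t)"
  shows "runs sim_step (sim T w t (int t)) 1 (sim T w (Suc t) (int (Suc t)))"
  unfolding sim_step_def
proof (rule runs_Act, rule ext)
  fix v
  have a: "decide_step (Suc (state_at w t)) (\<lambda>i. scan (sim T w t (int t)) (Work i)) = action_at w t"
    unfolding decide_step_def action_at_def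
    by (intro arg_cong2[where f = "delta M"] map_cong) (auto simp: scan_def sim_def)
  have "min (num_syms - 1) (Suc (fst (action_at w t))) = Suc (fst (action_at w t))"
    using action_at_bounds(1)[of w t] by (simp add: num_syms_def)
  moreover have "min (num_syms - 1) (fst (snd (action_at w t) ! i)) = fst (snd (action_at w t) ! i)" if "i < K" for i
    using action_at_bounds(3)[OF that, of w t] by (simp add: num_syms_def)
  moreover have "scan (sim T w t (int t)) State = Suc (state_at w t)"
    by (simp add: scan_def sim_def)
  moreover have "scan (sim T w t (int t)) (Work i) = read_tape (tape_at w t i)" if "i < K" for i
    using that by (simp add: scan_def sim_def)
  ultimately show "act_on ({State, State_Log} \<union> Work ` {..<K} \<union> Log ` {..<K}) (\<lambda>s v.
     let a = decide_step (s State) (\<lambda>i. s (Work i)) in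
     case v of
       State \<Rightarrow> (min (num_syms - 1) (Suc (fst a)), Stay)
     | State_Log \<Rightarrow> (s State, Move_Right)
     | Work i \<Rightarrow> (min (num_syms - 1) (fst (snd a ! i)), snd (snd a ! i))
     | Log i \<Rightarrow> (s (Work i), Move_Right)
     | _ \<Rightarrow> (s v, Stay)) (sim T w t (int t)) v = sim T w (Suc t) (int (Suc t)) v"
    using at_Suc[OF nh] a
    by (cases v) (auto simp: act_on_def Let_def sim_def fun_eq_iff image_iff)
qed

lemma runs_undo:
  assumes nh: "\<not> halted (state_at w t)"
  shows "runs (Seq undo_move undo_write) (sim T w (Suc t) (int t)) 3 (sim T w t (int t - 1))"
proof -
  define mid where "mid = (\<lambda>v. case v of
      Work i \<Rightarrow> if i < K then (fst (tape_at w (Suc t) i), snd (tape_at w t i)) else T v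
    | _ \<Rightarrow> sim T w (Suc t) (int t) v)"
  have a: "decide_step (scan (sim T w (Suc t) (int t)) State_Log) (\<lambda>i. scan (sim T w (Suc t) (int t)) (Log i)) = action_at w t"
    unfolding decide_step_def action_at_def
    by (intro arg_cong2[where f = "delta M"] map_cong) (auto simp: scan_def sim_def)
  have scanned: "scan (sim T w (Suc t) (int t)) (Work i) = read_tape (tape_at w (Suc t) i)" if "i < K" for i
    using that by (simp add: scan_def sim_def)
  have head: "move_head (opposite (snd (snd (action_at w t) ! i))) (snd (tape_at w (Suc t) i)) = snd (tape_at w t i)"
    and content: "((fst (tape_at w (Suc t) i))(snd (tape_at w t i) := read_tape (tape_at w t i)), snd (tape_at w t i)) = tape_at w t i"
    if "i < K" for i
    using at_Suc(2)[OF nh that] by (cases "tape_at w t i"; cases "snd (action_at w t) ! i"; simp)+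
  have "runs undo_move (sim T w (Suc t) (int t)) 1 mid"
    unfolding undo_move_def
    apply (rule runs_Act)
    apply (rule ext)
    subgoal for v
      using a head scanned
      by (cases v) (auto simp: act_on_def Let_def mid_def image_iff act_tape_same sim_def)
    done
  moreover have "runs undo_write mid 1 (sim T w t (int t - 1))"
    unfolding undo_write_def
    apply (rule runs_Act)
    apply (rule ext)
    subgoal for v
      using content
      by (cases v) (auto simp: act_on_def mid_def image_iff sim_def scan_def fun_eq_iff)
    done
  ultimately have "runs (Seq undo_move undo_write) (sim T w (Suc t) (int t)) (1 + 1 + 1) (sim T w t (int t - 1))"
    by (rule runs_Seq)
  then show ?thesis by (rule runs_mono) simp
qed

text \<open>
  As everything but the answer is undone, the call can be repeated. A step of \<open>M\<close> costs two steps of the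
  program forward and four backward, including the tests of the loops.
\<close>

lemma runs_call:
  assumes blank: "T State = blank_tape" "T State_Log = blank_tape" "T Flag = blank_tape"
      "\<And>i. 0 < i \<Longrightarrow> i < K \<Longrightarrow> T (Work i) = blank_tape" "\<And>i. i < K \<Longrightarrow> T (Log i) = blank_tape"
    and input: "T (Work 0) = input_tape w"
    and halts: "if b then accepts_within M w t else rejects_within M w t"
  shows "runs call T (6 * t + 20) (T(Flag := cell (if b then 1 else 0)))"
proof -
  have ends: "halted (state_at w t)"
    using halts by (auto simp: halted_def state_at_def config_at_def accepts_within_def rejects_within_def split: if_splits)
  define k where "k = (LEAST i. halted (state_at w i))"
  have kt: "k \<le> t" and hk: "halted (state_at w k)"
    unfolding k_def by (rule Least_le[where P = "\<lambda>i. halted (state_at w i)", OF ends],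
        rule LeastI[where P = "\<lambda>i. halted (state_at w i)", OF ends])
  have nh: "\<not> halted (state_at w i)" if "i < k" for i
    using not_less_Least[of i "\<lambda>i. halted (state_at w i)"] that by (simp add: k_def)
  have "state_at w (k + j) = state_at w k" for j
  proof (induction j)
    case (Suc j)
    obtain q ts where c: "config_at w (k + j) = (q, ts)" by fastforce
    then have "config_at w (k + Suc j) = tm_step M (q, ts)"
      by (simp add: config_at_def)
    moreover have "halted q" using Suc hk c by (simp add: state_at_def)
    ultimately show ?case using Suc c by (auto simp: state_at_def halted_def)
  qed simp
  then have "state_at w k = state_at w t"
    using kt by (metis le_add_diff_inverse)
  then have acc: "state_at w k = accept_state M \<longleftrightarrow> b"
    using halts wf_M
    by (auto simp: wf_tm_def state_at_def config_at_def accepts_within_def rejects_within_def split: if_splits)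
  define T' where "T' = T(Flag := cell (if b then 1 else 0))"
  \<comment> \<open>The simulation of zero steps is the initial situation; it also describes the situation after everything is undone.\<close>
  have zero: "sim U w 0 0 = U(State := cell (Suc (start_state M)))"
    if "U State_Log = blank_tape" "\<And>i. 0 < i \<Longrightarrow> i < K \<Longrightarrow> U (Work i) = blank_tape"
      "\<And>i. i < K \<Longrightarrow> U (Log i) = blank_tape" "U (Work 0) = input_tape w" for U
  proof (rule ext)
    fix v
    have "tape_at w 0 i = U (Work i)" if "i < K" for i
      using that \<open>U (Work 0) = input_tape w\<close> \<open>\<And>i. 0 < i \<Longrightarrow> i < K \<Longrightarrow> U (Work i) = blank_tape\<close>
      by (cases i) (auto simp: tape_at_def config_at_def initial_config_def)
    then show "sim U w 0 0 v = (U(State := cell (Suc (start_state M)))) v"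
      using that
      by (cases v) (auto simp: sim_def state_at_def config_at_def initial_config_def blank_tape_def fun_eq_iff)
  qed
  have start: "runs (put State (\<lambda>_. Suc (start_state M))) T 1 (sim T w 0 0)"
    by (rule runs_put'[where x = 0]) (use blank input zero in \<open>auto simp: cell_0\<close>)
  have forth: "runs (While (\<lambda>s. \<not> halted (s State - 1)) sim_step) (sim T w 0 0) (k * (1 + 1) + 1) (sim T w k (int k))"
    using runs_While[of k "\<lambda>s. \<not> halted (s State - 1)" "\<lambda>i. sim T w i (int i)" sim_step 1] nh hk runs_sim_step
    by (simp add: scan_def sim_def)
  have flag: "runs (put Flag (\<lambda>s. if s State - 1 = accept_state M then 1 else 0)) (sim T w k (int k)) 1 (sim T' w k (int k))"
    apply (rule runs_put'[where x = 0 and y = "if b then 1 else 0"])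
    using blank acc by (auto simp: sim_def cell_0 scan_def T'_def fun_eq_iff split: name.split)
  have left: "runs (shift logs Move_Left) (sim T' w k (int k)) 1 (sim T' w k (int k - 1))"
    by (rule runs_shift) (auto simp: sim_def logs_def split: name.split)
  have rewind: "runs (While (\<lambda>s. s State_Log \<noteq> 0) (Seq undo_move undo_write)) (sim T' w k (int k - 1)) (k * (3 + 1) + 1) (sim T' w 0 (-1))"
  proof -
    define F where "F = (\<lambda>i. sim T' w (k - i) (int (k - i) - 1))"
    have step: "runs (Seq undo_move undo_write) (F i) 3 (F (Suc i))" if "i < k" for i
    proof -
      define j where "j = k - Suc i"
      have "k - i = Suc j" "k - Suc i = j" "j < k" using that by (auto simp: j_def)
      then show ?thesis using runs_undo[OF nh, of j T'] by (simp add: F_def)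
    qed
    have cond: "(scan (F i) State_Log \<noteq> 0) = (i < k)" for i
      by (auto simp: F_def scan_def sim_def)
    have "runs (While (\<lambda>s. s State_Log \<noteq> 0) (Seq undo_move undo_write)) (F 0) (k * (3 + 1) + 1) (F k)"
      by (rule runs_While) (use step cond in auto)
    then show ?thesis by (simp add: F_def)
  qed
  have right: "runs (shift logs Move_Right) (sim T' w 0 (-1)) 1 (sim T' w 0 0)"
    by (rule runs_shift) (auto simp: sim_def logs_def split: name.split)
  have reset: "runs (put State (\<lambda>_. 0)) (sim T' w 0 0) 1 T'"
  proof -
    have "sim T' w 0 0 = T'(State := cell (Suc (start_state M)))"
      by (rule zero) (use blank input in \<open>auto simp: T'_def\<close>)
    then show ?thesis
      by (intro runs_put'[where y = 0]) (use blank in \<open>auto simp: T'_def cell_0\<close>)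
  qed
  have "runs call T (1 + ((k * (1 + 1) + 1) + (1 + (1 + ((k * (3 + 1) + 1) + (1 + 1 + 1) + 1) + 1) + 1) + 1) + 1) T'"
    unfolding call_def
    by (rule runs_Seq[OF start runs_Seq[OF forth runs_Seq[OF flag runs_Seq[OF left
          runs_Seq[OF rewind runs_Seq[OF right reset]]]]]])
  then show ?thesis
    unfolding T'_def using kt by (elim runs_mono) simp
qed

end

section \<open>Programs on vertex variables\<close>

text \<open>
  \<open>pos\<close> is the position on the input tape and \<open>out\<close> is the word written so far on the input tape of the
  called machine, with the head behind its last symbol.
\<close>

record store =
  pos :: nat
  out :: "bool list"
  flag :: bool

definition word_tape :: "bool list \<Rightarrow> int \<Rightarrow> tape" where
  "word_tape w h = (fst (input_tape w), h)"

text \<open>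
  A number from \<open>0\<close> to \<open>n\<close> is a head position on this tape. The blanks in the cells \<open>-1\<close> and \<open>n\<close> allow
  detecting both ends in one step.
\<close>

definition ruler :: "nat \<Rightarrow> int \<Rightarrow> tape" where
  "ruler n h = ((\<lambda>c. if 0 \<le> c \<and> c < int n then 1 else 0), h)"

lemma word_tape_0: "word_tape w 0 = input_tape w"
  by (simp add: word_tape_def input_tape_def)

lemma word_tape_Nil: "word_tape [] 0 = blank_tape"
  by (simp add: word_tape_def input_tape_def blank_tape_def fun_eq_iff)

lemma read_ruler [simp]: "read_tape (ruler n h) = (if 0 \<le> h \<and> h < int n then 1 else 0)"
  by (simp add: ruler_def)

lemma move_ruler [simp]: "(fst (ruler n h), h') = ruler n h'" "snd (ruler n h) = h"
  by (simp_all add: ruler_def)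

lemma read_word [simp]:
  "read_tape (word_tape w h) = (if 0 \<le> h \<and> h < int (length w) then (if w ! nat h then 2 else 1) else 0)"
  by (simp add: word_tape_def input_tape_def)

lemma move_word [simp]: "(fst (word_tape w h), h') = word_tape w h'" "snd (word_tape w h) = h"
  by (simp_all add: word_tape_def)

abbreviation vcount :: "'a graph \<Rightarrow> nat" where
  "vcount G \<equiv> card (verts G)"

lemma length_encode_graph: "length (encode_graph G) = vcount G + 1 + vcount G * vcount G"
  by (simp add: encode_graph_def Let_def length_concat comp_def sum_list_triv)

lemma nth_concat_rows:
  "i < n \<Longrightarrow> j < n' \<Longrightarrow> concat (map (\<lambda>i. map (f i) [0..<n']) [0..<n]) ! (i * n' + j) = f i j"
proof (induction n arbitrary: i)
  case (Suc n)
  have len: "length (concat (map (\<lambda>i. map (f i) [0..<n']) [0..<n])) = n * n'"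
    by (simp add: length_concat comp_def sum_list_triv)
  show ?case
  proof (cases "i < n")
    case True
    then have "i * n' + j < n * n'"
      using Suc.prems(2) mult_le_mono1[of "Suc i" n n'] by simp
    then show ?thesis using True Suc len by (simp add: nth_append)
  next
    case False
    then have "i = n" using Suc.prems by simp
    then show ?thesis using Suc.prems len by (simp add: nth_append)
  qed
qed simp

lemma encode_graph_entry:
  assumes "i < vcount G" "j < vcount G"
  shows "vcount G + 1 + i * vcount G + j < length (encode_graph G)"
    and "encode_graph G ! (vcount G + 1 + i * vcount G + j) \<longleftrightarrow> {i, j} \<in> edges G"
proof -
  have "i * vcount G + j < vcount G * vcount G"
    using assms mult_le_mono1[of "Suc i" "vcount G" "vcount G"] by simp
  then show "vcount G + 1 + i * vcount G + j < length (encode_graph G)"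
    by (simp add: length_encode_graph)
  show "encode_graph G ! (vcount G + 1 + i * vcount G + j) \<longleftrightarrow> {i, j} \<in> edges G"
    using nth_concat_rows[OF assms, of "\<lambda>i j. {i, j} \<in> edges G"]
    by (simp add: encode_graph_def Let_def nth_append)
qed

lemma encode_graph_prefix:
  "i < vcount G \<Longrightarrow> encode_graph G ! i" "\<not> encode_graph G ! vcount G"
  by (simp_all add: encode_graph_def Let_def nth_append)

lemma poly_bounded_Suc [intro!]: "poly_bounded f \<Longrightarrow> poly_bounded (\<lambda>n. Suc (f n))"
  using poly_bounded_add[of f "\<lambda>_. 1"] by simp

lemmas runs_shift_Suc = runs_shift[unfolded One_nat_def]
  and runs_put_Suc = runs_put'[unfolded One_nat_def]

context calling
begin

text \<open>
  Variables beyond the length of \<open>vs\<close> are at zero. Hence a loop over a new variable can start without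
  initialisation, and must reset the variable at its end.
\<close>

definition mem :: "nat graph \<Rightarrow> nat list \<Rightarrow> store \<Rightarrow> name \<Rightarrow> tape" where
  "mem G vs st v = (case v of
       In \<Rightarrow> word_tape (encode_graph G) (int (pos st))
     | Flag \<Rightarrow> cell (if flag st then 1 else 0)
     | Scratch \<Rightarrow> ruler (vcount G) 0
     | Var i \<Rightarrow> if i < R then ruler (vcount G) (if i < length vs then int (vs ! i) else 0) else blank_tape
     | Work i \<Rightarrow> if i = 0 then word_tape (out st) (int (length (out st))) else blank_tape
     | _ \<Rightarrow> blank_tape)"

lemma mem_simps:
  "mem G vs st In = word_tape (encode_graph G) (int (pos st))"
  "mem G vs st Flag = cell (if flag st then 1 else 0)"
  "mem G vs st Scratch = ruler (vcount G) 0"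
  "mem G vs st (Var i) = (if i < R then ruler (vcount G) (if i < length vs then int (vs ! i) else 0) else blank_tape)"
  "mem G vs st (Work i) = (if i = 0 then word_tape (out st) (int (length (out st))) else blank_tape)"
  "mem G vs st State = blank_tape" "mem G vs st State_Log = blank_tape" "mem G vs st (Log i) = blank_tape"
  by (simp_all add: mem_def)

definition valid :: "nat \<Rightarrow> nat graph \<Rightarrow> nat list \<Rightarrow> bool" where
  "valid m G vs \<longleftrightarrow> G \<in> graphs \<and> length vs = m \<and> set vs \<subseteq> {..<vcount G}"

text \<open>
  Within the precondition \<open>P\<close>, some program of polynomial running time has the effect \<open>F\<close> on the store and
  leaves the \<open>m\<close> variables in use unchanged. The program itself is hidden: the closure properties below are
  all that is needed of it.
\<close>

definition implements ::
  "nat \<Rightarrow> (nat graph \<Rightarrow> nat list \<Rightarrow> store \<Rightarrow> bool) \<Rightarrow> (nat graph \<Rightarrow> nat list \<Rightarrow> store \<Rightarrow> store) \<Rightarrow> bool"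
where
  "implements m P F \<longleftrightarrow> m \<le> R \<and> (\<exists>c B. wfc c \<and> poly_bounded B \<and>
     (\<forall>G vs st. valid m G vs \<longrightarrow> P G vs st \<longrightarrow>
        runs c (mem G vs st) (B (vcount G)) (mem G vs (F G vs st))))"

lemma implementsI:
  assumes "m \<le> R" "wfc c" "poly_bounded B"
    "\<And>G vs st. valid m G vs \<Longrightarrow> P G vs st \<Longrightarrow> runs c (mem G vs st) (B (vcount G)) (mem G vs (F G vs st))"
  shows "implements m P F"
  using assms unfolding implements_def by blast

lemma implements_cong:
  assumes "implements m P F"
    "\<And>G vs st. valid m G vs \<Longrightarrow> P' G vs st \<Longrightarrow> P G vs st \<and> F' G vs st = F G vs st"
  shows "implements m P' F'"
proof -
  from assms(1) obtain c B where "m \<le> R" "wfc c" "poly_bounded B"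
    and r: "\<And>G vs st. valid m G vs \<Longrightarrow> P G vs st \<Longrightarrow>
        runs c (mem G vs st) (B (vcount G)) (mem G vs (F G vs st))"
    unfolding implements_def by blast
  then show ?thesis
    using assms(2) by (intro implementsI[of m c B]) auto
qed

lemma implements_Seq:
  assumes "implements m P F" "implements m P' F'"
    "\<And>G vs st. valid m G vs \<Longrightarrow> P G vs st \<Longrightarrow> P' G vs (F G vs st)"
  shows "implements m P (\<lambda>G vs st. F' G vs (F G vs st))"
proof -
  from assms(1) obtain c B where c: "m \<le> R" "wfc c" "poly_bounded B"
    "\<And>G vs st. valid m G vs \<Longrightarrow> P G vs st \<Longrightarrow>
        runs c (mem G vs st) (B (vcount G)) (mem G vs (F G vs st))"
    unfolding implements_def by blast
  from assms(2) obtain c' B' where c': "wfc c'" "poly_bounded B'"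
    "\<And>G vs st. valid m G vs \<Longrightarrow> P' G vs st \<Longrightarrow>
        runs c' (mem G vs st) (B' (vcount G)) (mem G vs (F' G vs st))"
    unfolding implements_def by blast
  show ?thesis
    using c c' assms(3)
    by (intro implementsI[of m "Seq c c'" "\<lambda>n. B n + B' n + 1"])
       (auto simp del: One_nat_def intro!: runs_Seq)
qed

lemma implements_if_flag:
  assumes "implements m P F" "implements m P' F'"
  shows "implements m (\<lambda>G vs st. if flag st then P G vs st else P' G vs st)
           (\<lambda>G vs st. if flag st then F G vs st else F' G vs st)"
proof -
  from assms(1) obtain c B where c: "m \<le> R" "wfc c" "poly_bounded B"
    "\<And>G vs st. valid m G vs \<Longrightarrow> P G vs st \<Longrightarrow>
        runs c (mem G vs st) (B (vcount G)) (mem G vs (F G vs st))"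
    unfolding implements_def by blast
  from assms(2) obtain c' B' where c': "wfc c'" "poly_bounded B'"
    "\<And>G vs st. valid m G vs \<Longrightarrow> P' G vs st \<Longrightarrow>
        runs c' (mem G vs st) (B' (vcount G)) (mem G vs (F' G vs st))"
    unfolding implements_def by blast
  show ?thesis
  proof (rule implementsI[of m "If (\<lambda>s. s Flag = 1) c c'" "\<lambda>n. B n + B' n + 1"])
    fix G vs and st :: store
    assume v: "valid m G vs" and p: "if flag st then P G vs st else P' G vs st"
    have "scan (mem G vs st) Flag = (if flag st then 1 else 0)"
      by (simp add: scan_def mem_simps)
    then show "runs (If (\<lambda>s. s Flag = 1) c c') (mem G vs st) (B (vcount G) + B' (vcount G) + 1)
        (mem G vs (if flag st then F G vs st else F' G vs st))"
      using p c(4)[OF v, of st] c'(3)[OF v, of st] runs_mono[of c "mem G vs st" "B (vcount G)"]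
        runs_mono[of c' "mem G vs st" "B' (vcount G)"]
      by (intro runs_If) auto
  qed (use c c' in auto)
qed

lemma implements_skip: "m \<le> R \<Longrightarrow> implements m P (\<lambda>G vs st. st)"
  by (rule implementsI[of m "shift {} Stay" "\<lambda>_. 1"]) (auto intro: runs_shift_Suc)

lemma implements_set_flag: "m \<le> R \<Longrightarrow> implements m P (\<lambda>G vs st. st\<lparr>flag := f (flag st)\<rparr>)"
  by (rule implementsI[of m "put Flag (\<lambda>s. if f (s Flag = 1) then 1 else 0)" "\<lambda>_. 1"])
     (auto simp: wf_put num_syms_def mem_def scan_def fun_eq_iff
       split: name.splits intro!: runs_put_Suc[where x = "if flag _ then 1 else 0"])

lemma implements_read:
  "m \<le> R \<Longrightarrow> implements m (\<lambda>G vs st. pos st < length (encode_graph G))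
     (\<lambda>G vs st. st\<lparr>flag := encode_graph G ! pos st\<rparr>)"
  by (rule implementsI[of m "put Flag (\<lambda>s. if s In = 2 then 1 else 0)" "\<lambda>_. 1"])
     (auto simp: wf_put num_syms_def mem_def scan_def fun_eq_iff
       split: name.splits intro!: runs_put_Suc[where x = "if flag _ then 1 else 0"])

lemma implements_advance: "m \<le> R \<Longrightarrow> implements m P (\<lambda>G vs st. st\<lparr>pos := Suc (pos st)\<rparr>)"
  by (rule implementsI[of m "shift {In} Move_Right" "\<lambda>_. 1"])
     (auto simp: mem_def split: name.splits intro!: runs_shift_Suc simp: algebra_simps)

lemma runs_rewind:
  assumes T: "T x = word_tape w (int h)" and h: "h \<le> length w"
  shows "runs (Seq (shift {x} Move_Left)
            (Seq (While (\<lambda>s. s x \<noteq> 0) (shift {x} Move_Left)) (shift {x} Move_Right)))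
          T (2 * h + 5) (T(x := word_tape w 0))"
proof -
  define U where "U = (\<lambda>i. T(x := word_tape w (int h - 1 - int i)))"
  have "runs (shift {x} Move_Left) T 1 (U 0)"
    by (rule runs_shift) (auto simp: U_def T)
  moreover have "runs (While (\<lambda>s. s x \<noteq> 0) (shift {x} Move_Left)) (U 0) (h * (1 + 1) + 1) (U h)"
    by (rule runs_While) (use h in \<open>auto simp: U_def scan_def intro!: runs_shift_Suc simp: algebra_simps\<close>)
  moreover have "runs (shift {x} Move_Right) (U h) 1 (T(x := word_tape w 0))"
    by (rule runs_shift) (auto simp: U_def)
  ultimately have "runs (Seq (shift {x} Move_Left)
            (Seq (While (\<lambda>s. s x \<noteq> 0) (shift {x} Move_Left)) (shift {x} Move_Right)))
          T (1 + ((h * (1 + 1) + 1) + 1 + 1) + 1) (T(x := word_tape w 0))"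
    by (intro runs_Seq)
  then show ?thesis by (rule runs_mono) simp
qed

lemma implements_rewind:
  "m \<le> R \<Longrightarrow> implements m (\<lambda>G vs st. pos st \<le> length (encode_graph G)) (\<lambda>G vs st. st\<lparr>pos := 0\<rparr>)"
proof (rule implementsI[of m "Seq (shift {In} Move_Left)
            (Seq (While (\<lambda>s. s In \<noteq> 0) (shift {In} Move_Left)) (shift {In} Move_Right))"
       "\<lambda>n. 2 * (n + 1 + n * n) + 5"])
  fix G vs and st :: store
  assume p: "pos st \<le> length (encode_graph G)"
  have "mem G vs (st\<lparr>pos := 0\<rparr>) = (mem G vs st)(In := word_tape (encode_graph G) 0)"
    by (auto simp: mem_def fun_eq_iff split: name.splits)
  then show "runs (Seq (shift {In} Move_Left)
            (Seq (While (\<lambda>s. s In \<noteq> 0) (shift {In} Move_Left)) (shift {In} Move_Right)))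
         (mem G vs st) (2 * (vcount G + 1 + vcount G * vcount G) + 5) (mem G vs (st\<lparr>pos := 0\<rparr>))"
    using runs_rewind[of "mem G vs st" In "encode_graph G" "pos st"] p
    by (auto simp: mem_simps length_encode_graph elim: runs_mono)
qed auto

lemma implements_emit:
  "m \<le> R \<Longrightarrow> implements m P (\<lambda>G vs st. st\<lparr>out := out st @ [flag st], flag := False\<rparr>)"
proof (rule implementsI[of m "Act {Work 0, Flag} (\<lambda>s v. if v = Flag then (0, Stay)
    else (if s Flag = 1 then 2 else 1, Move_Right))" "\<lambda>_. 1"])
  fix G vs and st :: store
  have "act_tape (if flag st then 2 else 1, Move_Right) (word_tape (out st) (int (length (out st))))
      = word_tape (out st @ [flag st]) (int (Suc (length (out st))))"
    by (auto simp: word_tape_def input_tape_def fun_eq_iff nth_append)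
  then show "runs (Act {Work 0, Flag} (\<lambda>s v. if v = Flag then (0, Stay)
    else (if s Flag = 1 then 2 else 1, Move_Right))) (mem G vs st) 1
     (mem G vs (st\<lparr>out := out st @ [flag st], flag := False\<rparr>))"
    by (intro runs_Act) (auto simp: act_on_def scan_def mem_def fun_eq_iff split: name.splits)
qed (use K_pos in \<open>auto simp: num_syms_def\<close>)

lemma runs_rewind_ruler:
  assumes T: "\<And>y. y \<in> A \<Longrightarrow> T y = ruler n (int n)" and x: "x \<in> A"
  shows "runs (Seq (shift A Move_Left)
            (Seq (While (\<lambda>s. s x = 1) (shift A Move_Left)) (shift A Move_Right)))
          T (2 * n + 5) (\<lambda>y. if y \<in> A then ruler n 0 else T y)"
proof -
  define U where "U = (\<lambda>i y. if y \<in> A then ruler n (int n - 1 - int i) else T y)"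
  have "runs (shift A Move_Left) T 1 (U 0)"
    by (rule runs_shift) (auto simp: U_def T)
  moreover have "runs (While (\<lambda>s. s x = 1) (shift A Move_Left)) (U 0) (n * (1 + 1) + 1) (U n)"
    by (rule runs_While) (use x in \<open>auto simp: U_def scan_def intro!: runs_shift_Suc simp: algebra_simps\<close>)
  moreover have "runs (shift A Move_Right) (U n) 1 (\<lambda>y. if y \<in> A then ruler n 0 else T y)"
    by (rule runs_shift) (auto simp: U_def)
  ultimately have "runs (Seq (shift A Move_Left)
            (Seq (While (\<lambda>s. s x = 1) (shift A Move_Left)) (shift A Move_Right)))
          T (1 + ((n * (1 + 1) + 1) + 1 + 1) + 1) (\<lambda>y. if y \<in> A then ruler n 0 else T y)"
    by (intro runs_Seq)
  then show ?thesis by (rule runs_mono) simp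
qed

text \<open>
  The new variable is number \<open>m\<close>. The bound on its range is recognised by the blank behind the ruler,
  and the final sweep to the left returns the head to zero.
\<close>

lemma implements_for:
  assumes body: "implements (Suc m) P F"
    and inv: "\<And>G vs st i. valid m G vs \<Longrightarrow> P' G vs st \<Longrightarrow> i < vcount G \<Longrightarrow>
        P G (vs @ [i]) (fold (\<lambda>i. F G (vs @ [i])) [0..<i] st)"
  shows "implements m P' (\<lambda>G vs. fold (\<lambda>i. F G (vs @ [i])) [0..<vcount G])"
proof -
  from body obtain c B where c: "Suc m \<le> R" "wfc c" "poly_bounded B"
    and run: "\<And>G vs st. valid (Suc m) G vs \<Longrightarrow> P G vs st \<Longrightarrow>
        runs c (mem G vs st) (B (vcount G)) (mem G vs (F G vs st))"
    unfolding implements_def by blast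
  let ?loop = "While (\<lambda>s. s (Var m) = 1) (Seq c (shift {Var m} Move_Right))"
  let ?rew = "Seq (shift {Var m} Move_Left)
     (Seq (While (\<lambda>s. s (Var m) = 1) (shift {Var m} Move_Left)) (shift {Var m} Move_Right))"
  show ?thesis
  proof (rule implementsI[of m "Seq ?loop ?rew" "\<lambda>n. (n * (B n + 1 + 1 + 1) + 1) + (2 * n + 5) + 1"])
    fix G vs and st :: store
    assume v: "valid m G vs" and p: "P' G vs st"
    let ?n = "vcount G"
    define S where "S = (\<lambda>i. fold (\<lambda>i. F G (vs @ [i])) [0..<i] st)"
    define T where "T = (\<lambda>i. mem G (vs @ [i]) (S i))"
    have len: "length vs = m" using v by (simp add: valid_def)
    have S_Suc: "S (Suc i) = F G (vs @ [i]) (S i)" for i by (simp add: S_def)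
    have start: "mem G vs st = T 0"
      by (auto simp: T_def S_def mem_def fun_eq_iff nth_append len split: name.splits)
    have step: "runs (Seq c (shift {Var m} Move_Right)) (T i) (B ?n + 1 + 1) (T (Suc i))" if "i < ?n" for i
    proof (rule runs_Seq)
      have "valid (Suc m) G (vs @ [i])" using v that by (simp add: valid_def)
      then show "runs c (T i) (B ?n) (mem G (vs @ [i]) (S (Suc i)))"
        unfolding T_def S_Suc using run inv[OF v p that] by (simp add: S_def)
      show "runs (shift {Var m} Move_Right) (mem G (vs @ [i]) (S (Suc i))) 1 (T (Suc i))"
        using c(1) by (intro runs_shift)
          (auto simp: T_def mem_def nth_append len algebra_simps split: name.splits)
    qed
    have cond: "scan (T i) (Var m) = 1 \<longleftrightarrow> i < ?n" for i
      using c(1) by (simp add: scan_def T_def mem_simps nth_append len)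
    have "runs ?loop (T 0) (?n * (B ?n + 1 + 1 + 1) + 1) (T ?n)"
      by (rule runs_While) (use step cond in auto)
    moreover have "runs ?rew (T ?n) (2 * ?n + 5) (mem G vs (S ?n))"
    proof -
      have at_end: "T ?n y = ruler ?n (int ?n)" if "y \<in> {Var m}" for y
        using that c(1) by (simp add: T_def mem_simps nth_append len)
      have eq: "(\<lambda>y. if y \<in> {Var m} then ruler ?n 0 else T ?n y) = mem G vs (S ?n)"
        using c(1) by (auto simp: T_def mem_def nth_append len fun_eq_iff split: name.splits)
      show ?thesis
        unfolding eq[symmetric] by (rule runs_rewind_ruler) (simp_all only: at_end insertI1)
    qed
    ultimately have "runs (Seq ?loop ?rew) (T 0)
         ((?n * (B ?n + 1 + 1 + 1) + 1) + (2 * ?n + 5) + 1) (mem G vs (S ?n))"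
      by (rule runs_Seq)
    moreover have "fold (\<lambda>i. F G (vs @ [i])) [0..<?n] st = S ?n"
      by (simp add: S_def)
    ultimately show "runs (Seq ?loop ?rew) (mem G vs st)
         ((?n * (B ?n + 1 + 1 + 1) + 1) + (2 * ?n + 5) + 1)
         (mem G vs (fold (\<lambda>i. F G (vs @ [i])) [0..<?n] st))"
      by (simp only: start)
  qed (use c in auto)
qed

text \<open>
  Both heads move left together until one falls off the ruler; the test succeeds if the head of \<open>a\<close> does. The scratch head counts the steps so that they can be taken back.
\<close>

lemma implements_le:
  assumes "a < m" "b < m" "m \<le> R"
  shows "implements m P (\<lambda>G vs st. st\<lparr>flag := vs ! a \<le> vs ! b\<rparr>)"
proof -
  let ?down = "Act {Var a, Var b, Scratch} (\<lambda>s v. (s v, if v = Scratch then Move_Right else Move_Left))"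
  let ?up = "Act {Var a, Var b, Scratch} (\<lambda>s v. (s v, if v = Scratch then Move_Left else Move_Right))"
  let ?l1 = "While (\<lambda>s. s (Var a) = 1 \<and> s (Var b) = 1) ?down"
  let ?p = "put Flag (\<lambda>s. if s (Var a) = 1 then 0 else 1)"
  let ?l2 = "Seq (shift {Scratch} Move_Left) (Seq (While (\<lambda>s. s Scratch = 1) ?up) (shift {Scratch} Move_Right))"
  show ?thesis
  proof (rule implementsI[of m "Seq ?l1 (Seq ?p ?l2)" "\<lambda>n. 4 * n + 20"])
    fix G vs and st :: store
    assume v: "valid m G vs"
    let ?n = "vcount G" let ?x = "vs ! a" let ?y = "vs ! b"
    have len: "length vs = m" using v by (simp add: valid_def)
    have xy: "?x < ?n" "?y < ?n" using v assms by (auto simp: valid_def dest: nth_mem)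
    define T where "T = (\<lambda>st h i u. case u of Scratch \<Rightarrow> ruler ?n h
       | Var j \<Rightarrow> if j = a \<or> j = b then ruler ?n (int (vs ! j) - i) else mem G vs st (Var j) | _ \<Rightarrow> mem G vs st u)"
    have aR: "a < R" "b < R" using assms by auto
    \<comment> \<open>The blank in cell \<open>-1\<close> stops the loop, hence one step more than the minimum.\<close>
    define k where "k = Suc (min ?x ?y)"
    let ?st = "st\<lparr>flag := ?x \<le> ?y\<rparr>"
    have T0: "T st' 0 0 = mem G vs st'" for st'
      using aR assms by (auto simp: T_def mem_def fun_eq_iff len split: name.splits)
    have "runs ?l1 (T st (int 0) (int 0)) (k * (1 + 1) + 1) (T st (int k) (int k))"
    proof (rule runs_While[where T = "\<lambda>i. T st (int i) (int i)"])
      fix i assume "i < k"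
      then show "scan (T st (int i) (int i)) (Var a) = 1 \<and> scan (T st (int i) (int i)) (Var b) = 1"
        using xy by (auto simp: scan_def T_def k_def)
      show "runs ?down (T st (int i) (int i)) 1 (T st (int (Suc i)) (int (Suc i)))"
        by (rule runs_move) (auto simp: T_def algebra_simps split: name.splits)
    next
      show "\<not> (scan (T st (int k) (int k)) (Var a) = 1 \<and> scan (T st (int k) (int k)) (Var b) = 1)"
        by (auto simp: scan_def T_def k_def)
    qed
    moreover have "runs ?p (T st (int k) (int k)) 1 (T ?st (int k) (int k))"
    proof (rule runs_put'[where x = "if flag st then 1 else 0" and y = "if ?x \<le> ?y then 1 else 0"])
      show "(if scan (T st (int k) (int k)) (Var a) = 1 then 0 else 1) = (if ?x \<le> ?y then 1 else 0 :: nat)"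
        using xy by (auto simp: scan_def T_def k_def)
    qed (auto simp: T_def mem_def fun_eq_iff split: name.splits)
    moreover have "runs ?l2 (T ?st (int k) (int k)) (1 + ((k * (1 + 1) + 1) + 1 + 1) + 1) (T ?st 0 0)"
    proof (intro runs_Seq)
      define U where "U = (\<lambda>i. T ?st (int k - 1 - int i) (int k - int i))"
      show "runs (shift {Scratch} Move_Left) (T ?st (int k) (int k)) 1 (U 0)"
        by (rule runs_shift) (auto simp: U_def T_def split: name.splits)
      show "runs (While (\<lambda>s. s Scratch = 1) ?up) (U 0) (k * (1 + 1) + 1) (U k)"
      proof (rule runs_While)
        fix i assume "i < k"
        then show "scan (U i) Scratch = 1"
          using xy by (auto simp: scan_def U_def T_def k_def)
        show "runs ?up (U i) 1 (U (Suc i))"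
          by (rule runs_move) (auto simp: T_def U_def algebra_simps split: name.splits)
      qed (auto simp: scan_def U_def T_def)
      show "runs (shift {Scratch} Move_Right) (U k) 1 (T ?st 0 0)"
        by (rule runs_shift) (auto simp: U_def T_def split: name.splits)
    qed
    ultimately have "runs (Seq ?l1 (Seq ?p ?l2)) (mem G vs st)
        ((k * (1 + 1) + 1) + (1 + (1 + ((k * (1 + 1) + 1) + 1 + 1) + 1) + 1) + 1) (mem G vs ?st)"
      unfolding T0[symmetric] of_nat_0 by (rule runs_Seq[OF _ runs_Seq])
    then show "runs (Seq ?l1 (Seq ?p ?l2)) (mem G vs st) (4 * vcount G + 20) (mem G vs ?st)"
      by (rule runs_mono) (use xy in \<open>auto simp: k_def\<close>)
  qed (use assms in \<open>auto simp: wf_put num_syms_def\<close>)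
qed

text \<open>
  Besides the call itself, the word has to be rewound before it and erased after it, so that the next
  call finds the tape blank.
\<close>

lemma implements_call:
  assumes "m \<le> R" and B: "poly_bounded B"
    and P: "\<And>G vs st. valid m G vs \<Longrightarrow> P G vs st \<Longrightarrow> \<not> flag st \<and> length (out st) \<le> B (vcount G) \<and>
       (if Q G vs then accepts_within M (out st) (B (vcount G)) else rejects_within M (out st) (B (vcount G)))"
  shows "implements m P (\<lambda>G vs st. st\<lparr>out := [], flag := Q G vs\<rparr>)"
proof -
  let ?x = "Work 0"
  let ?rew = "Seq (shift {?x} Move_Left)
            (Seq (While (\<lambda>s. s ?x \<noteq> 0) (shift {?x} Move_Left)) (shift {?x} Move_Right))"
  let ?fwd = "While (\<lambda>s. s ?x \<noteq> 0) (shift {?x} Move_Right)"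
  let ?era = "While (\<lambda>s. s ?x \<noteq> 0) (Act {?x} (\<lambda>s v. (0, Move_Left)))"
  let ?c = "Seq ?rew (Seq call (Seq ?fwd (Seq (shift {?x} Move_Left) (Seq ?era (shift {?x} Move_Right)))))"
  show ?thesis
  proof (rule implementsI[of m ?c "\<lambda>n. 12 * B n + 100"])
    fix G vs and st :: store
    assume v: "valid m G vs" and p: "P G vs st"
    define w where "w = out st"
    let ?B = "B (vcount G)"
    have len: "length w \<le> ?B" and nf: "\<not> flag st"
      and halts: "if Q G vs then accepts_within M w ?B else rejects_within M w ?B"
      using P[OF v p] by (auto simp: w_def)
    define T where "T = (mem G vs st)(?x := word_tape w 0)"
    define T' where "T' = T(Flag := cell (if Q G vs then 1 else 0))"
    have r1: "runs ?rew (mem G vs st) (2 * length w + 5) T"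
      unfolding T_def by (rule runs_rewind) (auto simp: mem_simps w_def)
    have r2: "runs call T (6 * ?B + 20) T'"
      unfolding T'_def
      by (rule runs_call[OF _ _ _ _ _ _ halts]) (use nf in \<open>auto simp: T_def mem_simps cell_0 word_tape_0\<close>)
    have r3: "runs ?fwd T' (length w * (1 + 1) + 1) (T'(?x := word_tape w (int (length w))))"
    proof -
      define U where "U = (\<lambda>i. T'(?x := word_tape w (int i)))"
      have "runs ?fwd (U 0) (length w * (1 + 1) + 1) (U (length w))"
        by (rule runs_While) (auto simp: U_def scan_def intro!: runs_shift_Suc simp: algebra_simps)
      moreover have "U 0 = T'" by (simp add: U_def T'_def T_def fun_eq_iff)
      ultimately show ?thesis by (simp add: U_def)
    qed
    have r4: "runs (shift {?x} Move_Left) (T'(?x := word_tape w (int (length w)))) 1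
        (T'(?x := word_tape w (int (length w) - 1)))"
      by (rule runs_shift) auto
    have r5: "runs ?era (T'(?x := word_tape w (int (length w) - 1))) (length w * (1 + 1) + 1)
        (T'(?x := word_tape [] (-1)))"
    proof -
      define U where "U = (\<lambda>i. T'(?x := word_tape (take (length w - i) w) (int (length w - i) - 1)))"
      have "runs ?era (U 0) (length w * (1 + 1) + 1) (U (length w))"
      proof (rule runs_While)
        fix i assume i: "i < length w"
        define j where "j = length w - Suc i"
        have j: "length w - i = Suc j" "length w - Suc i = j" "j < length w" using i by (auto simp: j_def)
        show "scan (U i) ?x \<noteq> 0" using j by (simp add: U_def scan_def)
        have "act_tape (0, Move_Left) (word_tape (take (Suc j) w) (int j)) = word_tape (take j w) (int j - 1)"
        proof -
          have same: "take j w ! nat x = w ! nat x" if "0 \<le> x" "x < 1 + int j" "x \<noteq> int j" for x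
            using that j(3) by auto
          show ?thesis
            using j(3) by (auto simp: word_tape_def input_tape_def fun_eq_iff) (metis same)+
        qed
        then show "runs (Act {?x} (\<lambda>s v. (0, Move_Left))) (U i) 1 (U (Suc i))"
          by (intro runs_Act) (auto simp: U_def j act_on_def fun_eq_iff)
      qed (simp add: U_def scan_def)
      then show ?thesis by (simp add: U_def)
    qed
    have "T'(?x := word_tape [] 0) = mem G vs (st\<lparr>out := [], flag := Q G vs\<rparr>)"
      by (auto simp: T'_def T_def mem_def fun_eq_iff split: name.splits)
    moreover have "runs (shift {?x} Move_Right) (T'(?x := word_tape [] (-1))) 1 (T'(?x := word_tape [] 0))"
      by (rule runs_shift) auto
    ultimately have r6: "runs (shift {?x} Move_Right) (T'(?x := word_tape [] (-1))) 1
        (mem G vs (st\<lparr>out := [], flag := Q G vs\<rparr>))"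
      by (simp only:)
    have "runs ?c (mem G vs st)
       ((2 * length w + 5) + ((6 * ?B + 20) + ((length w * (1 + 1) + 1) + (1 + ((length w * (1 + 1) + 1) + 1 + 1) + 1) + 1) + 1) + 1)
       (mem G vs (st\<lparr>out := [], flag := Q G vs\<rparr>))"
      by (rule runs_Seq[OF r1 runs_Seq[OF r2 runs_Seq[OF r3 runs_Seq[OF r4 runs_Seq[OF r5 r6]]]]])
    then show "runs ?c (mem G vs st) (12 * ?B + 100) (mem G vs (st\<lparr>out := [], flag := Q G vs\<rparr>))"
      by (rule runs_mono) (use len in auto)
  qed (use assms K_pos wf_call in \<open>auto simp: num_syms_def\<close>)
qed

end

section \<open>Deciding formulas in polynomial time\<close>

lemma accepts_within_mono: "accepts_within M w t \<Longrightarrow> t \<le> u \<Longrightarrow> accepts_within M w u"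
  and rejects_within_mono: "rejects_within M w t \<Longrightarrow> t \<le> u \<Longrightarrow> rejects_within M w u"
proof -
  have "fst ((tm_step M ^^ (t + j)) (initial_config M w)) = fst ((tm_step M ^^ t) (initial_config M w))"
    if "fst ((tm_step M ^^ t) (initial_config M w)) \<in> {accept_state M, reject_state M}" for j
  proof (induction j)
    case (Suc j)
    obtain q ts where c: "(tm_step M ^^ (t + j)) (initial_config M w) = (q, ts)" by fastforce
    then show ?case using Suc that by auto
  qed simp
  from this[of "u - t"]
  show "accepts_within M w t \<Longrightarrow> t \<le> u \<Longrightarrow> accepts_within M w u"
    and "rejects_within M w t \<Longrightarrow> t \<le> u \<Longrightarrow> rejects_within M w u"
    by (auto simp: accepts_within_def rejects_within_def)
qed

text \<open>
  The flag \<open>e\<close> says that the input tape of the called machine has to be free. It holds for formulas that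
  contain calls, but not for those evaluated while an input for a call is being written.
\<close>

definition idle :: "bool \<Rightarrow> store \<Rightarrow> bool" where
  "idle e st \<longleftrightarrow> pos st = 0 \<and> \<not> flag st \<and> (e \<longrightarrow> out st = [])"

lemma flag_update_same [simp]: "\<not> flag st \<Longrightarrow> st\<lparr>flag := False\<rparr> = st"
  by (cases st) simp

lemma store_update_same [simp]: "st\<lparr>pos := pos st\<rparr> = st" "st\<lparr>out := out st\<rparr> = st" "st\<lparr>flag := flag st\<rparr> = st"
  by (cases st; simp)+

context calling
begin

lemma implements_cond:
  assumes test: "implements m P (\<lambda>G vs st. st\<lparr>flag := \<phi> G vs\<rparr>)"
    and F: "implements m (\<lambda>G vs st. P G vs st \<and> \<phi> G vs) F"
    and F': "implements m (\<lambda>G vs st. P G vs st \<and> \<not> \<phi> G vs) F'"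
    and P: "\<And>G vs st. P G vs st \<Longrightarrow> \<not> flag st"
  shows "implements m P (\<lambda>G vs st. if \<phi> G vs then F G vs st else F' G vs st)"
proof -
  have m: "m \<le> R" using test by (simp add: implements_def)
  let ?Q = "\<lambda>\<chi> G vs st. P G vs (st\<lparr>flag := False\<rparr>) \<and> \<chi> G vs"
  have 1: "implements m (?Q \<phi>) (\<lambda>G vs st. F G vs (st\<lparr>flag := False\<rparr>))"
    by (rule implements_Seq[OF implements_set_flag[OF m, where f = "\<lambda>_. False"] F]) simp
  have 2: "implements m (?Q (\<lambda>G vs. \<not> \<phi> G vs)) (\<lambda>G vs st. F' G vs (st\<lparr>flag := False\<rparr>))"
    by (rule implements_Seq[OF implements_set_flag[OF m, where f = "\<lambda>_. False"] F']) simp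
  show ?thesis
    by (rule implements_cong[OF implements_Seq[OF test implements_if_flag[OF 1 2]]]) (auto, (frule P, simp)+)
qed

text \<open>
  \<open>\<phi>\<close> is a formula in \<open>m\<close> vertex variables; \<open>P\<close> is what may be assumed about them.
\<close>

definition decides :: "bool \<Rightarrow> nat \<Rightarrow> (nat graph \<Rightarrow> nat list \<Rightarrow> bool) \<Rightarrow> (nat graph \<Rightarrow> nat list \<Rightarrow> bool) \<Rightarrow> bool" where
  "decides e m P \<phi> \<longleftrightarrow> implements m (\<lambda>G vs st. P G vs \<and> idle e st) (\<lambda>G vs st. st\<lparr>flag := \<phi> G vs\<rparr>)"

lemma decides_le_R: "decides e m P \<phi> \<Longrightarrow> m \<le> R"
  by (simp add: decides_def implements_def)

lemma decides_cong:
  assumes "decides e m P \<phi>"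
    "\<And>G vs. valid m G vs \<Longrightarrow> P' G vs \<Longrightarrow> P G vs \<and> \<phi>' G vs = \<phi> G vs"
  shows "decides e m P' \<phi>'"
  unfolding decides_def
  by (rule implements_cong[OF assms(1)[unfolded decides_def]]) (use assms(2) in auto)

lemma decides_const: "m \<le> R \<Longrightarrow> decides e m P (\<lambda>G vs. b)"
  unfolding decides_def by (rule implements_set_flag)

lemma decides_le: "a < m \<Longrightarrow> b < m \<Longrightarrow> m \<le> R \<Longrightarrow> decides e m P (\<lambda>G vs. vs ! a \<le> vs ! b)"
  unfolding decides_def by (rule implements_le)

lemma decides_not:
  assumes "decides e m P \<phi>"
  shows "decides e m P (\<lambda>G vs. \<not> \<phi> G vs)"
  unfolding decides_def
  by (rule implements_cong[OF implements_Seq[OF assms[unfolded decides_def]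
        implements_set_flag[where f = Not and P = "\<lambda>_ _ _. True"]]])
     (use decides_le_R[OF assms] in auto)

text \<open>
  The second formula is evaluated only if the first one holds. This is essential: a called machine may run
  forever outside its class, so calls have to be guarded by the conditions that put the graph into
  the class.
\<close>

lemma decides_and:
  assumes 1: "decides e m P \<phi>" and 2: "decides e m (\<lambda>G vs. P G vs \<and> \<phi> G vs) \<psi>"
  shows "decides e m P (\<lambda>G vs. \<phi> G vs \<and> \<psi> G vs)"
proof -
  have "implements m (\<lambda>G vs st. (P G vs \<and> idle e st) \<and> \<phi> G vs) (\<lambda>G vs st. st\<lparr>flag := \<psi> G vs\<rparr>)"
    by (rule implements_cong[OF 2[unfolded decides_def]]) auto
  from implements_cond[OF 1[unfolded decides_def] this implements_skip[OF decides_le_R[OF 1]]]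
  show ?thesis
    unfolding decides_def by (rule implements_cong) (auto simp: idle_def)
qed

lemma decides_or:
  assumes 1: "decides e m P \<phi>" and 2: "decides e m P \<psi>"
  shows "decides e m P (\<lambda>G vs. \<phi> G vs \<or> \<psi> G vs)"
proof -
  have "decides e m (\<lambda>G vs. P G vs \<and> \<not> \<phi> G vs) (\<lambda>G vs. \<not> \<psi> G vs)"
    by (rule decides_cong[OF decides_not[OF 2]]) simp
  from decides_not[OF decides_and[OF decides_not[OF 1] this]] show ?thesis by simp
qed

lemma decides_eq:
  assumes "a < m" "b < m" "m \<le> R"
  shows "decides e m P (\<lambda>G vs. vs ! a = vs ! b)"
  by (rule decides_cong[OF decides_and[OF decides_le[of a m b] decides_le[of b m a]]]) (use assms in auto)

lemma decides_all_less:
  fixes r :: nat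
  assumes "m \<le> R" "\<And>l. l < r \<Longrightarrow> decides e m P (\<lambda>G vs. \<phi> l G vs)"
  shows "decides e m P (\<lambda>G vs. \<forall>l<r. \<phi> l G vs)"
  using assms(2)
proof (induction r)
  case 0
  show ?case using decides_const[OF assms(1), of e P True] by simp
next
  case (Suc r)
  have "decides e m (\<lambda>G vs. P G vs \<and> (\<forall>l<r. \<phi> l G vs)) (\<phi> r)"
    by (rule decides_cong[OF Suc.prems[of r]]) auto
  from decides_and[OF Suc.IH this] Suc.prems show ?case
    by (auto simp: less_Suc_eq conj_commute all_conj_distrib cong: conj_cong elim!: decides_cong)
qed

lemma decides_ex_less:
  fixes r :: nat
  assumes "m \<le> R" "\<And>l. l < r \<Longrightarrow> decides e m P (\<lambda>G vs. \<phi> l G vs)"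
  shows "decides e m P (\<lambda>G vs. \<exists>l<r. \<phi> l G vs)"
proof -
  have "decides e m P (\<lambda>G vs. \<forall>l<r. \<not> \<phi> l G vs)"
    using assms by (intro decides_all_less decides_not)
  from decides_not[OF this] show ?thesis by simp
qed

text \<open>
  The loop does not stop at a witness; from then on, its body does nothing.
\<close>

lemma decides_ex:
  assumes body: "decides e (Suc m) P' \<phi>"
    and P: "\<And>G vs i. valid m G vs \<Longrightarrow> P G vs \<Longrightarrow> i < vcount G \<Longrightarrow> P' G (vs @ [i])"
  shows "decides e m P (\<lambda>G vs. \<exists>i<vcount G. \<phi> G (vs @ [i]))"
proof -
  have m: "Suc m \<le> R" using decides_le_R[OF body] .
  define F :: "nat graph \<Rightarrow> nat list \<Rightarrow> store \<Rightarrow> store" where "F = (\<lambda>G vs st. if flag st then st else st\<lparr>flag := \<phi> G vs\<rparr>)"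
  have F: "implements (Suc m) (\<lambda>G vs st. if flag st then True else P' G vs \<and> idle e st) F"
    unfolding F_def
    by (rule implements_if_flag[OF implements_skip[OF m] body[unfolded decides_def]])
  have fold: "fold (\<lambda>i. F G (vs @ [i])) [0..<k] st = st\<lparr>flag := \<exists>i<k. \<phi> G (vs @ [i])\<rparr>"
    if "idle e st" for G vs st k
  proof (induction k)
    case 0
    then show ?case using that by (simp add: idle_def)
  next
    case (Suc k)
    then show ?case by (cases "\<exists>i<k. \<phi> G (vs @ [i])") (simp_all add: F_def Ex_less_Suc cong: conj_cong)
  qed
  have "implements m (\<lambda>G vs st. P G vs \<and> idle e st) (\<lambda>G vs. fold (\<lambda>i. F G (vs @ [i])) [0..<vcount G])"
    by (rule implements_for[OF F]) (use P in \<open>auto simp: fold\<close>, auto simp: idle_def)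
  then show ?thesis
    unfolding decides_def by (rule implements_cong) (simp add: fold)
qed

lemma decides_ex_list:
  assumes "decides e (m + r) (\<lambda>G us. P G (take m us)) \<phi>"
  shows "decides e m P (\<lambda>G vs. \<exists>ws. length ws = r \<and> set ws \<subseteq> {..<vcount G} \<and> \<phi> G (vs @ ws))"
  using assms
proof (induction r arbitrary: m P)
  case 0
  then have "decides e m (\<lambda>G us. P G (take m us)) \<phi>" by simp
  then show ?case by (rule decides_cong) (auto simp: valid_def)
next
  case (Suc r)
  have "decides e (Suc m) (\<lambda>G us. P G (take m us))
     (\<lambda>G vs. \<exists>ws. length ws = r \<and> set ws \<subseteq> {..<vcount G} \<and> \<phi> G (vs @ ws))"
    using Suc.prems by (intro Suc.IH) (simp add: min_def)
  then have "decides e m P (\<lambda>G vs. \<exists>i<vcount G.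
      \<exists>ws. length ws = r \<and> set ws \<subseteq> {..<vcount G} \<and> \<phi> G ((vs @ [i]) @ ws))"
    by (rule decides_ex) (simp add: valid_def)
  then show ?case
  proof (rule decides_cong)
    fix G :: "nat graph" and vs
    have "(\<exists>ws. length ws = Suc r \<and> set ws \<subseteq> {..<vcount G} \<and> \<phi> G (vs @ ws)) \<longleftrightarrow>
       (\<exists>i ws. length ws = r \<and> set (i # ws) \<subseteq> {..<vcount G} \<and> \<phi> G (vs @ i # ws))"
    proof safe
      fix ws assume "length ws = Suc r" "set ws \<subseteq> {..<vcount G}" "\<phi> G (vs @ ws)"
      then show "\<exists>i ws. length ws = r \<and> set (i # ws) \<subseteq> {..<vcount G} \<and> \<phi> G (vs @ i # ws)"
        by (cases ws) auto
    next
      fix i ws assume "set (i # ws) \<subseteq> {..<vcount G}" "\<phi> G (vs @ i # ws)" "r = length ws"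
      then show "\<exists>us. length us = Suc (length ws) \<and> set us \<subseteq> {..<vcount G} \<and> \<phi> G (vs @ us)"
        by (intro exI[of _ "i # ws"]) simp
    qed
    then show "P G vs \<Longrightarrow> P G vs \<and> (\<exists>ws. length ws = Suc r \<and> set ws \<subseteq> {..<vcount G} \<and> \<phi> G (vs @ ws)) =
       (\<exists>i<vcount G. \<exists>ws. length ws = r \<and> set ws \<subseteq> {..<vcount G} \<and> \<phi> G ((vs @ [i]) @ ws))"
      by auto
  qed
qed

text \<open>
  Multiplication as a loop: the inner program runs once for every \<open>i\<close> below the value of the variable
  \<open>a\<close>.
\<close>

lemma implements_advance_times:
  assumes "a < m" "Suc m \<le> R"
    and k: "implements (Suc m) (\<lambda>_ _ _. True) (\<lambda>G vs st. st\<lparr>pos := pos st + k G\<rparr>)"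
  shows "implements m (\<lambda>G vs st. \<not> flag st) (\<lambda>G vs st. st\<lparr>pos := pos st + vs ! a * k G\<rparr>)"
proof -
  have less: "implements (Suc m) (\<lambda>G vs st. \<not> flag st) (\<lambda>G vs st. st\<lparr>flag := \<not> vs ! a \<le> vs ! m\<rparr>)"
    by (rule implements_cong[OF implements_Seq[OF implements_le[of a "Suc m" m] implements_set_flag[where f = Not and P = "\<lambda>_ _ _. True"]]])
       (use assms in auto)
  define F :: "nat graph \<Rightarrow> nat list \<Rightarrow> store \<Rightarrow> store" where "F = (\<lambda>G vs st. if \<not> vs ! a \<le> vs ! m then st\<lparr>pos := pos st + k G\<rparr> else st)"
  have F: "implements (Suc m) (\<lambda>G vs st. \<not> flag st) F"
    unfolding F_def
    by (rule implements_cond[OF less _ implements_skip[OF assms(2)]])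
       (auto intro: implements_cong[OF k])
  have fold: "fold (\<lambda>i. F G (vs @ [i])) [0..<j] st = st\<lparr>pos := pos st + min (vs ! a) j * k G\<rparr>"
    if "length vs = m" for G vs st j
  proof (induction j)
    case (Suc j)
    have "F G (vs @ [j]) st' = (if j < vs ! a then st'\<lparr>pos := pos st' + k G\<rparr> else st')" for st'
      using that assms(1) by (auto simp: F_def nth_append)
    moreover have "min (vs ! a) (Suc j) * k G = min (vs ! a) j * k G + (if j < vs ! a then k G else 0)"
    proof (cases "j < vs ! a")
      case True
      then have "min (vs ! a) (Suc j) = Suc j" "min (vs ! a) j = j" by simp_all
      then show ?thesis using True by simp
    qed (simp add: min_def)
    ultimately show ?case using Suc by simp
  qed simp
  have "implements m (\<lambda>G vs st. \<not> flag st) (\<lambda>G vs. fold (\<lambda>i. F G (vs @ [i])) [0..<vcount G])"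
    by (rule implements_for[OF F]) (auto simp: fold valid_def)
  then show ?thesis
  proof (rule implements_cong)
    fix G vs and st :: store
    assume v: "valid m G vs" and "\<not> flag st"
    have "vs ! a \<in> set vs" using v assms(1) by (simp add: valid_def)
    then have "vs ! a < vcount G" using v by (auto simp: valid_def)
    then have "min (vs ! a) (vcount G) = vs ! a" by simp
    then show "\<not> flag st \<and> st\<lparr>pos := pos st + vs ! a * k G\<rparr> = fold (\<lambda>i. F G (vs @ [i])) [0..<vcount G] st"
      using v \<open>\<not> flag st\<close> by (simp add: fold valid_def)
  qed
qed

lemma implements_advance_vcount:
  assumes "Suc m \<le> R"
  shows "implements m P (\<lambda>G vs st. st\<lparr>pos := pos st + vcount G\<rparr>)"
proof -
  have fold: "fold (\<lambda>i st. st\<lparr>pos := Suc (pos st)\<rparr>) [0..<j] st = st\<lparr>pos := pos st + j\<rparr>" for j and st :: store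
    by (induction j) auto
  have "implements m P (\<lambda>G vs. fold (\<lambda>i st. st\<lparr>pos := Suc (pos st)\<rparr>) [0..<vcount G])"
    by (rule implements_for[OF implements_advance[OF assms]]) auto
  then show ?thesis by (rule implements_cong) (simp add: fold)
qed

text \<open>
  The bit for the pair \<open>(i, j)\<close> is at position \<open>n + 1 + i * n + j\<close> of the input.
\<close>

lemma decides_edge:
  assumes "a < m" "b < m" "Suc (Suc m) \<le> R"
  shows "decides e m P (\<lambda>G vs. {vs ! a, vs ! b} \<in> edges G)"
proof -
  have m: "m \<le> R" "Suc m \<le> R" using assms by auto
  let ?P = "\<lambda>G vs st. \<not> flag st"
  have 1: "implements m ?P (\<lambda>G vs st. st\<lparr>pos := Suc (pos st + vcount G)\<rparr>)"
    by (rule implements_cong[OF implements_Seq[OF implements_advance_vcount[OF m(2)] implements_advance[OF m(1)]]])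
       auto
  have 2: "implements m ?P (\<lambda>G vs st. st\<lparr>pos := pos st + vs ! a * vcount G\<rparr>)"
    by (rule implements_advance_times[OF assms(1) m(2) implements_advance_vcount[OF assms(3)]])
  have 3: "implements m ?P (\<lambda>G vs st. st\<lparr>pos := pos st + vs ! b * 1\<rparr>)"
    by (rule implements_advance_times[OF assms(2) m(2)])
       (use implements_advance[OF m(2)] in simp)
  have 4: "implements m ?P (\<lambda>G vs st. st\<lparr>pos := pos st + (vcount G + 1 + vs ! a * vcount G + vs ! b)\<rparr>)"
    by (rule implements_cong[OF implements_Seq[OF 1 implements_Seq[OF 2 3]]]) (auto simp: algebra_simps)
  have 5: "implements m (\<lambda>G vs st. pos st < length (encode_graph G))
     (\<lambda>G vs st. st\<lparr>flag := encode_graph G ! pos st, pos := 0\<rparr>)"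
    by (rule implements_Seq[OF implements_read[OF m(1)] implements_rewind[OF m(1)]]) auto
  have bound: "vs ! a < vcount G" "vs ! b < vcount G" if "valid m G vs" for G vs
  proof -
    have "vs ! a \<in> set vs" "vs ! b \<in> set vs" using that assms by (simp_all add: valid_def)
    then show "vs ! a < vcount G" "vs ! b < vcount G" using that by (auto simp: valid_def)
  qed
  have 6: "implements m (\<lambda>G vs st. idle e st)
     (\<lambda>G vs st. st\<lparr>flag := encode_graph G ! (vcount G + 1 + vs ! a * vcount G + vs ! b), pos := 0\<rparr>)"
  proof -
    have 7: "implements m (\<lambda>G vs st. idle e st)
       (\<lambda>G vs st. st\<lparr>pos := pos st + (vcount G + 1 + vs ! a * vcount G + vs ! b)\<rparr>)"
      by (rule implements_cong[OF 4]) (simp add: idle_def)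
    show ?thesis
      by (rule implements_cong[OF implements_Seq[OF 7 5]])
        (use encode_graph_entry(1)[OF bound] in \<open>auto simp: idle_def\<close>)
  qed
  show ?thesis
    unfolding decides_def
  proof (rule implements_cong[OF 6])
    fix G vs and st :: store
    assume v: "valid m G vs" and i: "P G vs \<and> idle e st"
    have "encode_graph G ! (vcount G + 1 + vs ! a * vcount G + vs ! b) \<longleftrightarrow> {vs ! a, vs ! b} \<in> edges G"
      by (rule encode_graph_entry(2)[OF bound[OF v]])
    moreover have "st\<lparr>flag := x, pos := 0\<rparr> = st\<lparr>flag := x\<rparr>" for x
      using i by (cases st) (simp add: idle_def)
    ultimately show "idle e st \<and> st\<lparr>flag := {vs ! a, vs ! b} \<in> edges G\<rparr> =
       st\<lparr>flag := encode_graph G ! (vcount G + 1 + vs ! a * vcount G + vs ! b), pos := 0\<rparr>"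
      using i by simp
  qed
qed

text \<open>
  The word \<open>g G vs\<close> is appended to the input tape of the called machine.
\<close>

definition generates :: "nat \<Rightarrow> (nat graph \<Rightarrow> nat list \<Rightarrow> bool) \<Rightarrow> (nat graph \<Rightarrow> nat list \<Rightarrow> bool list) \<Rightarrow> bool" where
  "generates m P g \<longleftrightarrow> implements m (\<lambda>G vs st. P G vs \<and> idle False st) (\<lambda>G vs st. st\<lparr>out := out st @ g G vs\<rparr>)"

lemma generates_cong:
  assumes "generates m P g" "\<And>G vs. valid m G vs \<Longrightarrow> P' G vs \<Longrightarrow> P G vs \<and> g' G vs = g G vs"
  shows "generates m P' g'"
  unfolding generates_def
  by (rule implements_cong[OF assms(1)[unfolded generates_def]]) (use assms(2) in auto)

lemma generates_le_R: "generates m P g \<Longrightarrow> m \<le> R"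
  by (simp add: generates_def implements_def)

lemma generates_Nil: "m \<le> R \<Longrightarrow> generates m P (\<lambda>G vs. [])"
  unfolding generates_def by (rule implements_cong[OF implements_skip]) auto

lemma generates_bit:
  assumes "decides False m P \<phi>"
  shows "generates m P (\<lambda>G vs. [\<phi> G vs])"
  unfolding generates_def
proof (rule implements_cong[OF implements_Seq[OF assms[unfolded decides_def]
        implements_emit[where P = "\<lambda>_ _ _. True"]]])
  fix G vs and st :: store
  assume "P G vs \<and> idle False st"
  then show "(P G vs \<and> idle False st) \<and> st\<lparr>out := out st @ [\<phi> G vs]\<rparr> =
      st\<lparr>flag := \<phi> G vs, out := out (st\<lparr>flag := \<phi> G vs\<rparr>) @ [flag (st\<lparr>flag := \<phi> G vs\<rparr>)], flag := False\<rparr>"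
    by (cases st) (simp add: idle_def)
qed (use decides_le_R[OF assms] in auto)

lemma generates_append:
  assumes "generates m P g" "generates m P h"
  shows "generates m P (\<lambda>G vs. g G vs @ h G vs)"
  unfolding generates_def
  by (rule implements_cong[OF implements_Seq[OF assms[unfolded generates_def]]]) (auto simp: idle_def)

lemma generates_if:
  assumes 1: "decides False m P \<phi>" and 2: "generates m P g"
  shows "generates m P (\<lambda>G vs. if \<phi> G vs then g G vs else [])"
proof -
  have "implements m (\<lambda>G vs st. (P G vs \<and> idle False st) \<and> \<phi> G vs) (\<lambda>G vs st. st\<lparr>out := out st @ g G vs\<rparr>)"
    by (rule implements_cong[OF 2[unfolded generates_def]]) auto
  from implements_cond[OF 1[unfolded decides_def] this implements_skip[OF decides_le_R[OF 1]]]
  show ?thesis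
    unfolding generates_def by (rule implements_cong) (auto simp: idle_def)
qed

lemma generates_concat:
  assumes "m \<le> R" "\<And>q. q < p \<Longrightarrow> generates m P (g q)"
  shows "generates m P (\<lambda>G vs. concat (map (\<lambda>q. g q G vs) [0..<p]))"
  using assms(2)
proof (induction p)
  case (Suc p)
  then show ?case using generates_append[of m P "\<lambda>G vs. concat (map (\<lambda>q. g q G vs) [0..<p])" "g p"] by simp
qed (simp add: generates_Nil assms(1))

lemma generates_for:
  assumes body: "generates (Suc m) P' g"
    and P: "\<And>G vs i. valid m G vs \<Longrightarrow> P G vs \<Longrightarrow> i < vcount G \<Longrightarrow> P' G (vs @ [i])"
  shows "generates m P (\<lambda>G vs. concat (map (\<lambda>i. g G (vs @ [i])) [0..<vcount G]))"
proof -
  have fold: "fold (\<lambda>i st. st\<lparr>out := out st @ h i\<rparr>) [0..<k] st = st\<lparr>out := out st @ concat (map h [0..<k])\<rparr>"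
    for h k and st :: store
    by (induction k) auto
  have "implements m (\<lambda>G vs st. P G vs \<and> idle False st)
     (\<lambda>G vs. fold (\<lambda>i st. st\<lparr>out := out st @ g G (vs @ [i])\<rparr>) [0..<vcount G])"
    by (rule implements_for[OF body[unfolded generates_def]]) (use P in \<open>auto simp: fold idle_def\<close>)
  then show ?thesis
    unfolding generates_def by (rule implements_cong) (simp add: fold)
qed

lemma decides_call:
  assumes g: "generates m P g" and "poly_bounded B"
    and halts: "\<And>G vs. valid m G vs \<Longrightarrow> P G vs \<Longrightarrow> length (g G vs) \<le> B (vcount G) \<and>
       (if Q G vs then accepts_within M (g G vs) (B (vcount G)) else rejects_within M (g G vs) (B (vcount G)))"
  shows "decides True m P Q"
proof -
  have 1: "implements m (\<lambda>G vs st. P G vs \<and> \<not> flag st \<and> out st = g G vs) (\<lambda>G vs st. st\<lparr>out := [], flag := Q G vs\<rparr>)"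
    by (rule implements_call[OF generates_le_R[OF g] assms(2)]) (use halts in auto)
  have 2: "implements m (\<lambda>G vs st. P G vs \<and> idle True st) (\<lambda>G vs st. st\<lparr>out := out st @ g G vs\<rparr>)"
    by (rule implements_cong[OF g[unfolded generates_def]]) (auto simp: idle_def)
  have "implements m (\<lambda>G vs st. P G vs \<and> idle True st)
      (\<lambda>G vs st. st\<lparr>out := out st @ g G vs\<rparr>\<lparr>out := [], flag := Q G vs\<rparr>)"
    by (rule implements_Seq[OF 2 1]) (auto simp: idle_def)
  then show ?thesis
    unfolding decides_def
  proof (rule implements_cong)
    fix G vs and st :: store
    assume "P G vs \<and> idle True st"
    then show "(P G vs \<and> idle True st) \<and> st\<lparr>flag := Q G vs\<rparr> =
         st\<lparr>out := out st @ g G vs, out := [], flag := Q G vs\<rparr>"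
      by (cases st) (simp add: idle_def)
  qed
qed

definition counters :: "name set" where
  "counters = insert Scratch (Var ` {..<R})"

text \<open>
  The code of a graph starts with \<open>n\<close> in unary, and copying this prefix to all counter tapes turns them into
  rulers of length \<open>n\<close>.
\<close>

definition prepare :: "name cmd" where
  "prepare = Seq (While (\<lambda>s. s In = 2) (Act (insert In counters) (\<lambda>s v. (if v = In then s In else 1, Move_Right))))
    (Seq (shift (insert In counters) Move_Left)
      (Seq (While (\<lambda>s. s Scratch = 1) (shift (insert In counters) Move_Left))
        (shift (insert In counters) Move_Right)))"

lemma wf_prepare: "wfc prepare"
  by (auto simp: prepare_def counters_def num_syms_def)

lemma runs_prepare:
  "runs prepare ((\<lambda>_. blank_tape)(In := input_tape (encode_graph G))) (4 * vcount G + 10)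
     (mem G [] \<lparr>pos = 0, out = [], flag = False\<rparr>)"
proof -
  let ?n = "vcount G"
  define U where "U = (\<lambda>i v. if v = In then word_tape (encode_graph G) (int i)
    else if v \<in> counters then ruler i (int i) else blank_tape)"
  define W where "W = (\<lambda>i v. if v = In then word_tape (encode_graph G) (int ?n - 1 - int i)
    else if v \<in> counters then ruler ?n (int ?n - 1 - int i) else blank_tape)"
  have In: "In \<notin> counters" and Scr: "Scratch \<in> counters" by (auto simp: counters_def)
  have len: "?n < length (encode_graph G)" by (simp add: length_encode_graph)
  have "(\<lambda>_. blank_tape)(In := input_tape (encode_graph G)) = U 0"
    by (auto simp: U_def fun_eq_iff word_tape_0 ruler_def blank_tape_def)
  moreover have "runs (While (\<lambda>s. s In = 2) (Act (insert In counters) (\<lambda>s v. (if v = In then s In else 1, Move_Right))))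
      (U 0) (?n * (1 + 1) + 1) (U ?n)"
  proof (rule runs_While)
    fix i assume i: "i < ?n"
    then show "scan (U i) In = 2" using len encode_graph_prefix(1)[OF i] by (simp add: U_def scan_def)
    have U: "U j v = (if v = In then word_tape (encode_graph G) (int j)
      else if v \<in> counters then ruler j (int j) else blank_tape)" for j v
      by (simp add: U_def)
    have "act_tape (1, Move_Right) (ruler i (int i)) = ruler (Suc i) (int (Suc i))"
      by (auto simp: ruler_def fun_eq_iff)
    then show "runs (Act (insert In counters) (\<lambda>s v. (if v = In then s In else 1, Move_Right))) (U i) 1 (U (Suc i))"
      using U act_tape_scan[of "U i" In Move_Right]
      by (intro runs_Act) (auto simp: act_on_def fun_eq_iff In algebra_simps)
  next
    show "scan (U ?n) In \<noteq> 2" using encode_graph_prefix(2)[of G] by (simp add: U_def scan_def)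
  qed
  moreover have "runs (shift (insert In counters) Move_Left) (U ?n) 1 (W 0)"
    by (rule runs_shift) (auto simp: U_def W_def)
  moreover have "runs (While (\<lambda>s. s Scratch = 1) (shift (insert In counters) Move_Left)) (W 0) (?n * (1 + 1) + 1) (W ?n)"
    by (rule runs_While) (use Scr in \<open>auto simp: W_def scan_def algebra_simps intro!: runs_shift_Suc\<close>)
  moreover have "runs (shift (insert In counters) Move_Right) (W ?n) 1 (mem G [] \<lparr>pos = 0, out = [], flag = False\<rparr>)"
    by (rule runs_shift) (auto simp: W_def mem_def counters_def cell_0 word_tape_Nil split: name.splits)
  ultimately have "runs prepare ((\<lambda>_. blank_tape)(In := input_tape (encode_graph G)))
      ((?n * (1 + 1) + 1) + (1 + ((?n * (1 + 1) + 1) + 1 + 1) + 1) + 1)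
      (mem G [] \<lparr>pos = 0, out = [], flag = False\<rparr>)"
    unfolding prepare_def by (simp only: runs_Seq)
  then show ?thesis by (rule runs_mono) simp
qed

lemma poly_time_solvable_if_decides:
  assumes dec: "decides True 0 (\<lambda>G vs. G \<in> C) (\<lambda>G vs. Q G)" and C: "C \<subseteq> graphs"
  shows "poly_time_solvable C encode_graph Q"
proof -
  from dec obtain c B where c: "wfc c" "poly_bounded B"
    and run: "\<And>G vs st. valid 0 G vs \<Longrightarrow> G \<in> C \<and> idle True st \<Longrightarrow>
       runs c (mem G vs st) (B (vcount G)) (mem G vs (st\<lparr>flag := Q G\<rparr>))"
    unfolding decides_def implements_def by blast
  have wf: "wfc (Seq prepare c)" using c wf_prepare by simp
  obtain M' where M': "wf_tm M'"
    "\<And>w t T b. exec (Seq prepare c) ((\<lambda>_. blank_tape)(In := input_tape w)) t T \<Longrightarrow>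
       read_tape (T Flag) = (if b then 1 else 0) \<Longrightarrow>
       if b then accepts_within M' w (Suc t) else rejects_within M' w (Suc t)"
    by (rule program_machine[OF wf finite_names]) (auto simp: num_syms_def)
  have "poly_bounded (\<lambda>n. Suc ((4 * n + 10) + B n + 1))"
    using c(2) by (intro poly_bounded_Suc poly_bounded_add poly_bounded_mult) auto
  then obtain p where p: "\<And>n. Suc ((4 * n + 10) + B n + 1) \<le> poly p n"
    unfolding poly_bounded_def by blast
  have "if Q G then accepts_within M' (encode_graph G) (poly p (length (encode_graph G)))
        else rejects_within M' (encode_graph G) (poly p (length (encode_graph G)))" if G: "G \<in> C" for G
  proof -
    let ?st = "\<lparr>pos = 0, out = [], flag = False\<rparr>"
    have "runs c (mem G [] ?st) (B (vcount G)) (mem G [] (?st\<lparr>flag := Q G\<rparr>))"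
      by (rule run) (use G C in \<open>auto simp: valid_def idle_def\<close>)
    from runs_Seq[OF runs_prepare this] obtain t
      where t: "t \<le> (4 * vcount G + 10) + B (vcount G) + 1"
      and ex: "exec (Seq prepare c) ((\<lambda>_. blank_tape)(In := input_tape (encode_graph G))) t (mem G [] (?st\<lparr>flag := Q G\<rparr>))"
      unfolding runs_def by blast
    have res: "if Q G then accepts_within M' (encode_graph G) (Suc t) else rejects_within M' (encode_graph G) (Suc t)"
      by (rule M'(2)[OF ex]) (simp add: mem_simps)
    have "Suc t \<le> poly p (vcount G)" using t p[of "vcount G"] by linarith
    also have "\<dots> \<le> poly p (length (encode_graph G))"
      by (rule poly_nat_mono) (simp add: length_encode_graph)
    finally show ?thesis
      using res by (auto intro: accepts_within_mono rejects_within_mono split: if_splits)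
  qed
  then show ?thesis
    unfolding poly_time_solvable_def using M'(1) by blast
qed

end

section \<open>Calling a Dominating Set machine\<close>

definition solves_domination :: "tm \<Rightarrow> nat poly \<Rightarrow> nat graph set \<Rightarrow> bool" where
  "solves_domination M p C \<longleftrightarrow> (\<forall>G\<in>C. \<forall>k\<ge>1.
     if domination_number G \<le> k
     then accepts_within M (encode_graph_nat (G, k)) (poly p (length (encode_graph_nat (G, k))))
     else rejects_within M (encode_graph_nat (G, k)) (poly p (length (encode_graph_nat (G, k)))))"

text \<open>
  The rows and columns of the \<open>n\<close> old and the \<open>p\<close> new vertices are separated, because variables only range over
  old vertices, while the constantly many new ones are treated by unrolling.
\<close>

lemma encode_graph_extension:
  assumes "vcount G' = n + p"
  shows "encode_graph G' = replicate n True @ replicate p True @ [False] @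
     concat (map (\<lambda>i. map (\<lambda>j. {i, j} \<in> edges G') [0..<n] @ map (\<lambda>q. {i, n + q} \<in> edges G') [0..<p]) [0..<n]) @
     concat (map (\<lambda>q. map (\<lambda>j. {n + q, j} \<in> edges G') [0..<n] @ map (\<lambda>r. {n + q, n + r} \<in> edges G') [0..<p]) [0..<p])"
proof -
  have "[0..<n + p] = [0..<n] @ map (\<lambda>q. n + q) [0..<p]"
    using upt_add_eq_append[of 0 n p] map_add_upt[of n p] by (simp add: add.commute)
  then show ?thesis
    by (simp add: encode_graph_def Let_def assms replicate_add comp_def)
qed

context calling
begin

text \<open>
  The graph \<open>G'\<close> extends the vertex set by \<open>p\<close> independent vertices; \<open>\<psi>\<close> and \<open>\<chi>\<close> define its adjacencies among
  old vertices and between old and new ones. The formulas get the bound as the value of variable \<open>a\<close>, raised by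
  one because values start at \<open>0\<close> and instances of Dominating Set at \<open>1\<close>.
\<close>

lemma decides_domination:
  fixes G' :: "nat graph \<Rightarrow> nat list \<Rightarrow> nat graph"
  assumes a: "a < m" "m < R"
    and solves: "solves_domination M pol C"
    and \<psi>: "decides False (Suc (Suc m)) (\<lambda>_ _. True) \<psi>"
    and \<chi>: "\<And>q. q < p \<Longrightarrow> decides False (Suc m) (\<lambda>_ _. True) (\<chi> q)"
    and G': "\<And>G vs. valid m G vs \<Longrightarrow> P G vs \<Longrightarrow> G' G vs \<in> C \<and> vcount (G' G vs) = vcount G + p"
    and old: "\<And>G vs i j. valid m G vs \<Longrightarrow> P G vs \<Longrightarrow> i < vcount G \<Longrightarrow> j < vcount G \<Longrightarrow>
       {i, j} \<in> edges (G' G vs) \<longleftrightarrow> \<psi> G (vs @ [i, j])"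
    and cross: "\<And>G vs i q. valid m G vs \<Longrightarrow> P G vs \<Longrightarrow> i < vcount G \<Longrightarrow> q < p \<Longrightarrow>
       {i, vcount G + q} \<in> edges (G' G vs) \<longleftrightarrow> \<chi> q G (vs @ [i])"
    and new: "\<And>G vs q r. valid m G vs \<Longrightarrow> P G vs \<Longrightarrow> q < p \<Longrightarrow> r < p \<Longrightarrow>
       {vcount G + q, vcount G + r} \<notin> edges (G' G vs)"
  shows "decides True m P (\<lambda>G vs. domination_number (G' G vs) \<le> Suc (vs ! a))"
proof -
  have m: "m \<le> R" "Suc m \<le> R" "Suc (Suc m) \<le> R"
    using a(2) decides_le_R[OF \<psi>] by auto
  let ?T = "\<lambda>_ _. True"
  note bit = generates_bit[OF decides_const]
  have g1: "generates m ?T (\<lambda>G vs. concat (map (\<lambda>i. [True]) [0..<vcount G]))"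
    by (rule generates_for[OF bit[OF m(2)]]) simp
  have g2: "generates m ?T (\<lambda>G vs. concat (map (\<lambda>q. [True]) [0..<p]))"
    by (rule generates_concat[OF m(1) bit[OF m(1)]])
  have g3: "generates m ?T (\<lambda>G vs. concat (map (\<lambda>i.
      concat (map (\<lambda>j. [\<psi> G ((vs @ [i]) @ [j])]) [0..<vcount G]) @
      concat (map (\<lambda>q. [\<chi> q G (vs @ [i])]) [0..<p])) [0..<vcount G]))"
    by (rule generates_for[OF generates_append[OF generates_for[OF generates_bit[OF \<psi>]]
          generates_concat[OF m(2) generates_bit[OF \<chi>]]]]) simp_all
  have g4: "generates m ?T (\<lambda>G vs. concat (map (\<lambda>q.
      concat (map (\<lambda>j. [\<chi> q G (vs @ [j])]) [0..<vcount G]) @ concat (map (\<lambda>r. [False]) [0..<p])) [0..<p]))"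
    by (rule generates_concat[OF m(1) generates_append[OF generates_for[OF generates_bit[OF \<chi>]]
          generates_concat[OF m(1) bit[OF m(1)]]]]) simp_all
  \<comment> \<open>The bound in unary: one symbol for every \<open>i\<close> up to the value of \<open>a\<close>.\<close>
  have g5: "generates m ?T (\<lambda>G vs. concat (map (\<lambda>i. if (vs @ [i]) ! m \<le> (vs @ [i]) ! a then [True] else []) [0..<vcount G]))"
    by (rule generates_for[OF generates_if[OF decides_le bit[OF m(2)]]]) (use a in auto)
  note g = generates_append[OF g1 generates_append[OF g2 generates_append[OF bit[OF m(1), of _ False]
          generates_append[OF g3 generates_append[OF g4 g5]]]]]
  have single: "concat (map (\<lambda>x. [f x]) xs) = map f xs" for f :: "nat \<Rightarrow> bool" and xs
    by (induction xs) auto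
  have word: "generates m P (\<lambda>G vs. encode_graph_nat (G' G vs, Suc (vs ! a)))"
  proof (rule generates_cong[OF g])
    fix G vs
    assume v: "valid m G vs" and P: "P G vs"
    have vc: "vcount (G' G vs) = vcount G + p" using G'[OF v P] by simp
    have len: "length vs = m" using v by (simp add: valid_def)
    have "vs ! a \<in> set vs" using a len by simp
    then have less: "vs ! a < vcount G" using v by (auto simp: valid_def)
    have "concat (map (\<lambda>i. if i \<le> x then [True] else []) [0..<j]) = replicate (min (Suc x) j) True" for x j :: nat
      by (induction j) (auto simp: min_def replicate_append_same not_less_eq_eq le_antisym)
    then have unary: "concat (map (\<lambda>i. if (vs @ [i]) ! m \<le> (vs @ [i]) ! a then [True] else []) [0..<vcount G])
        = replicate (Suc (vs ! a)) True"
      using less len a by (simp add: nth_append min_def)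
    have cross': "{vcount G + q, i} \<in> edges (G' G vs) \<longleftrightarrow> \<chi> q G (vs @ [i])" if "i < vcount G" "q < p" for i q
      using cross[OF v P that] by (simp add: insert_commute)
    have "encode_graph (G' G vs) = replicate (vcount G) True @ replicate p True @ [False] @
     concat (map (\<lambda>i. map (\<lambda>j. \<psi> G (vs @ [i, j])) [0..<vcount G] @ map (\<lambda>q. \<chi> q G (vs @ [i])) [0..<p]) [0..<vcount G]) @
     concat (map (\<lambda>q. map (\<lambda>j. \<chi> q G (vs @ [j])) [0..<vcount G] @ map (\<lambda>r. False) [0..<p]) [0..<p])"
      unfolding encode_graph_extension[OF vc]
      by (intro arg_cong2[where f = "(@)"] arg_cong[where f = concat] map_cong refl) (simp_all add: old[OF v P] cross[OF v P] cross' new[OF v P])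
    then show "True \<and> encode_graph_nat (G' G vs, Suc (vs ! a)) =
       concat (map (\<lambda>i. [True]) [0..<vcount G]) @ concat (map (\<lambda>q. [True]) [0..<p]) @ [False] @
       concat (map (\<lambda>i. concat (map (\<lambda>j. [\<psi> G ((vs @ [i]) @ [j])]) [0..<vcount G]) @
         concat (map (\<lambda>q. [\<chi> q G (vs @ [i])]) [0..<p])) [0..<vcount G]) @
       concat (map (\<lambda>q. concat (map (\<lambda>j. [\<chi> q G (vs @ [j])]) [0..<vcount G]) @
         concat (map (\<lambda>r. [False]) [0..<p])) [0..<p]) @
       concat (map (\<lambda>i. if (vs @ [i]) ! m \<le> (vs @ [i]) ! a then [True] else []) [0..<vcount G])"
      unfolding single unary by (simp add: map_replicate_const)
  qed
  define L where "L = (\<lambda>n. (n + p) + 1 + (n + p) * (n + p) + n)"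
  have L: "poly_bounded L"
    unfolding L_def by (intro poly_bounded_add poly_bounded_mult poly_bounded_const poly_bounded_id)
  show ?thesis
  proof (rule decides_call[OF word, where B = "\<lambda>n. L n + poly pol (L n)"])
    show "poly_bounded (\<lambda>n. L n + poly pol (L n))"
      using L by (intro poly_bounded_add poly_bounded_poly)
    fix G vs
    assume v: "valid m G vs" and P: "P G vs"
    let ?w = "encode_graph_nat (G' G vs, Suc (vs ! a))"
    have "vs ! a \<in> set vs" using a v by (simp add: valid_def)
    then have "vs ! a < vcount G" using v by (auto simp: valid_def)
    then have len: "length ?w \<le> L (vcount G)"
      using G'[OF v P] by (simp add: length_encode_graph L_def)
    then have le: "poly pol (length ?w) \<le> L (vcount G) + poly pol (L (vcount G))"
      using poly_nat_mono[OF len, of pol] by simp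
    have "if domination_number (G' G vs) \<le> Suc (vs ! a) then accepts_within M ?w (poly pol (length ?w))
       else rejects_within M ?w (poly pol (length ?w))"
      using solves G'[OF v P] unfolding solves_domination_def
      by (metis One_nat_def Suc_le_mono le0)
    then show "length ?w \<le> L (vcount G) + poly pol (L (vcount G)) \<and>
       (if domination_number (G' G vs) \<le> Suc (vs ! a)
        then accepts_within M ?w (L (vcount G) + poly pol (L (vcount G)))
        else rejects_within M ?w (L (vcount G) + poly pol (L (vcount G))))"
      using len accepts_within_mono[OF _ le] rejects_within_mono[OF _ le] by (auto split: if_splits)
  qed
qed

lemma decides_remaining_edge:
  assumes "i < m" "j < m" "2 * d \<le> m" "Suc (Suc m) \<le> R"
  shows "decides e m P (\<lambda>G vs. {vs ! i, vs ! j} \<in> edges (delete_edges G (edge_set d vs)))"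
proof -
  have mem: "x \<in> edge_set d vs \<longleftrightarrow> (\<exists>l<d. x = {vs ! l, vs ! (d + l)})" for x :: "nat set" and vs
    by (auto simp: edge_set_def)
  have "decides e m P' (\<lambda>G vs. \<forall>l<d. \<not> ((vs ! i = vs ! l \<and> vs ! j = vs ! (d + l)) \<or>
      (vs ! i = vs ! (d + l) \<and> vs ! j = vs ! l)))" for P'
    by (intro decides_all_less decides_not decides_or decides_and decides_eq) (use assms in auto)
  from decides_and[OF decides_edge[of i m j e P] this] show ?thesis
    by (rule decides_cong) (use assms in \<open>auto simp: mem doubleton_eq_iff\<close>)
qed

end

section \<open>The three cases\<close>

context calling
begin

lemma bondage_via_lists:
  assumes d: "d \<ge> 1" and C: "C \<subseteq> graphs"
    and dec: "decides True (2 * d) (\<lambda>G xs. G \<in> C \<and> (\<forall>l<d. {xs ! l, xs ! (d + l)} \<in> edges G))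
       (\<lambda>G xs. domination_number G < domination_number (delete_edges G (edge_set d xs)))"
      and R: "2 * d + 2 \<le> R"
  shows "bondage_poly_time d C"
proof -
  let ?E = "\<lambda>G xs. \<forall>l<d. {xs ! l, xs ! (d + l)} \<in> edges G"
  have "decides True (2 * d) (\<lambda>G xs. G \<in> C) (\<lambda>G xs. ?E G xs)"
    by (intro decides_all_less decides_edge) (use R in auto)
  from decides_and[OF this dec]
  have "decides True (0 + 2 * d) (\<lambda>G xs. G \<in> C) (\<lambda>G xs. ?E G xs \<and>
      domination_number G < domination_number (delete_edges G (edge_set d xs)))"
    by simp
  from decides_ex_list[OF this]
  have "decides True 0 (\<lambda>G vs. G \<in> C) (\<lambda>G vs. \<exists>ws. length ws = 2 * d \<and> set ws \<subseteq> {..<vcount G} \<and>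
      ?E G (vs @ ws) \<and> domination_number G < domination_number (delete_edges G (edge_set d (vs @ ws))))" .
  then have "decides True 0 (\<lambda>G vs. G \<in> C) (\<lambda>G vs. bondage_number G \<le> enat d)"
  proof (rule decides_cong)
    fix G vs
    assume v: "valid 0 G vs" and G: "G \<in> C"
    have "G \<in> graphs" "vs = []" using C G v by (auto simp: valid_def)
    then show "G \<in> C \<and> (bondage_number G \<le> enat d) = (\<exists>ws. length ws = 2 * d \<and> set ws \<subseteq> {..<vcount G} \<and>
      ?E G (vs @ ws) \<and> domination_number G < domination_number (delete_edges G (edge_set d (vs @ ws))))"
      using bondage_number_le_iff_list[OF simple_graph_if_graphs d, of G] verts_graphs[of G] G by simp
  qed
  then show ?thesis
    unfolding bondage_poly_time_def by (rule poly_time_solvable_if_decides[OF _ C])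
qed

text \<open>
  A threshold of the form \<open>k + 1\<close> with \<open>k < n\<close> suffices: \<open>\<gamma>(G)\<close> itself is one, being positive in a
  nonempty graph and smaller than \<open>\<gamma>(G - F) \<le> n\<close>.
\<close>

lemma increase_via_threshold:
  assumes C: "C \<subseteq> graphs" and d: "d \<ge> 1" and R: "2 * d < R"
    and P: "\<And>G xs. P G xs \<Longrightarrow> G \<in> C"
    and 1: "decides True (Suc (2 * d)) (\<lambda>G us. P G (take (2 * d) us)) (\<lambda>G us. domination_number G \<le> Suc (us ! (2 * d)))"
    and 2: "decides True (Suc (2 * d)) (\<lambda>G us. P G (take (2 * d) us))
        (\<lambda>G us. domination_number (delete_edges G (edge_set d us)) \<le> Suc (us ! (2 * d)))"
  shows "decides True (2 * d) P
     (\<lambda>G xs. domination_number G < domination_number (delete_edges G (edge_set d xs)))"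
proof -
  have 2: "decides True (Suc (2 * d)) (\<lambda>G us. P G (take (2 * d) us) \<and> domination_number G \<le> Suc (us ! (2 * d)))
        (\<lambda>G us. \<not> domination_number (delete_edges G (edge_set d us)) \<le> Suc (us ! (2 * d)))"
    by (rule decides_cong[OF decides_not[OF 2]]) simp
  have "decides True (2 * d) P (\<lambda>G xs. \<exists>k<vcount G. domination_number G \<le> Suc ((xs @ [k]) ! (2 * d)) \<and>
     \<not> domination_number (delete_edges G (edge_set d (xs @ [k]))) \<le> Suc ((xs @ [k]) ! (2 * d)))"
    by (rule decides_ex[OF decides_and[OF 1 2]]) (simp add: valid_def)
  then show ?thesis
  proof (rule decides_cong)
    fix G xs
    assume v: "valid (2 * d) G xs" and "P G xs"
    then have G: "G \<in> graphs" using P C by blast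
    have len: "length xs = 2 * d" using v by (simp add: valid_def)
    have es: "edge_set d (xs @ [k]) = edge_set d xs" for k
      unfolding edge_set_def by (intro image_cong) (auto simp: nth_append len)
    let ?F = "edge_set d xs"
    have "set xs \<noteq> {}" using len d by auto
    then have pos: "0 < vcount G" using v by (cases "vcount G") (auto simp: valid_def)
    have fin: "finite (verts G)" using simple_graph_if_graphs[OF G] by (simp add: simple_graph_def)
    have dom: "dominating_set (delete_edges G ?F) (verts G)" by (auto simp: dominating_set_def)
    then have bound: "domination_number (delete_edges G ?F) \<le> vcount G"
      using domination_number_le_iff[of "delete_edges G ?F"] fin by auto
    have "(\<exists>k<vcount G. domination_number G \<le> Suc k \<and> \<not> domination_number (delete_edges G ?F) \<le> Suc k) \<longleftrightarrow>
      domination_number G < domination_number (delete_edges G ?F)"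
    proof
      assume lt: "domination_number G < domination_number (delete_edges G ?F)"
      have "domination_number G \<noteq> 0"
      proof
        assume "domination_number G = 0"
        then obtain S where S: "dominating_set G S" "card S = 0"
          using domination_number_le_iff[OF fin, of 0] by auto
        then have "S = {}" using fin by (auto simp: dominating_set_def dest: finite_subset)
        then have "verts G = {}" using S(1) by (auto simp: dominating_set_def)
        then show False using pos by simp
      qed
      then have "domination_number G - 1 < vcount G \<and> domination_number G \<le> Suc (domination_number G - 1) \<and>
         \<not> domination_number (delete_edges G ?F) \<le> Suc (domination_number G - 1)"
        using lt bound by auto
      then show "\<exists>k<vcount G. domination_number G \<le> Suc k \<and> \<not> domination_number (delete_edges G ?F) \<le> Suc k"
        by blast
    qed auto
    then show "P G xs \<and> (domination_number G < domination_number (delete_edges G ?F)) =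
      (\<exists>k<vcount G. domination_number G \<le> Suc ((xs @ [k]) ! (2 * d)) \<and>
        \<not> domination_number (delete_edges G (edge_set d (xs @ [k]))) \<le> Suc ((xs @ [k]) ! (2 * d)))"
      using \<open>P G xs\<close> by (simp add: es nth_append len)
  qed
qed

end

text \<open>
  Both \<open>G\<close> and \<open>G - F\<close> are in the class, so the thresholds are tested directly.
\<close>

lemma bondage_closed_under_deletion:
  assumes d: "d \<ge> 1" and C: "C \<subseteq> graphs"
    and closed: "closed_under_edge_deletions C" and ds: "dominating_set_poly_time C"
  shows "bondage_poly_time d C"
proof -
  obtain M pol where M: "wf_tm M" and sol: "solves_domination M pol C"
    using ds unfolding dominating_set_poly_time_def poly_time_solvable_def solves_domination_def by fastforce
  interpret calling M "2 * d + 5" by unfold_locales (rule M)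
  let ?m = "Suc (2 * d)"
  let ?P = "\<lambda>G xs. G \<in> C \<and> (\<forall>l<d. {xs ! l, xs ! (d + l)} \<in> edges G)"
  have edge: "decides False (Suc (Suc ?m)) P (\<lambda>G vs. {vs ! ?m, vs ! Suc ?m} \<in> edges G)" for P
    by (rule decides_edge) auto
  have rest: "decides False (Suc (Suc ?m)) P
      (\<lambda>G vs. {vs ! ?m, vs ! Suc ?m} \<in> edges (delete_edges G (edge_set d vs)))" for P
    by (rule decides_remaining_edge) auto
  have 1: "decides True ?m (\<lambda>G us. ?P G (take (2 * d) us)) (\<lambda>G us. domination_number G \<le> Suc (us ! (2 * d)))"
    by (rule decides_domination[OF _ _ sol edge, where p = 0 and G' = "\<lambda>G us. G" and \<chi> = "\<lambda>_ _ _. True"])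
       (auto simp: valid_def nth_append)
  have 2: "decides True ?m (\<lambda>G us. ?P G (take (2 * d) us))
      (\<lambda>G us. domination_number (delete_edges G (edge_set d us)) \<le> Suc (us ! (2 * d)))"
  proof (rule decides_domination[OF _ _ sol rest, where p = 0 and \<chi> = "\<lambda>_ _ _. True"])
    fix G us
    assume v: "valid ?m G us" and P: "?P G (take (2 * d) us)"
    have len: "length us = ?m" using v by (simp add: valid_def)
    have "edge_set d us \<subseteq> edges G" using P by (auto simp: edge_set_def)
    moreover have "finite (edge_set d us)" by (simp add: edge_set_def)
    ultimately show "delete_edges G (edge_set d us) \<in> C \<and> vcount (delete_edges G (edge_set d us)) = vcount G + 0"
      using closed_delete_edges[OF closed] P by simp
    have es: "edge_set d (us @ ws) = edge_set d us" for ws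
      unfolding edge_set_def by (intro image_cong) (auto simp: nth_append len)
    show "({i, j} \<in> edges (delete_edges G (edge_set d us))) =
      ({(us @ [i, j]) ! ?m, (us @ [i, j]) ! Suc ?m} \<in> edges (delete_edges G (edge_set d (us @ [i, j]))))" for i j
      by (simp add: es nth_append len)
  qed auto
  show ?thesis
    by (rule bondage_via_lists[OF d C increase_via_threshold[OF C d _ _ 1 2]]) auto
qed

text \<open>
  The threshold for \<open>G - F\<close> is tested through the graphs with pendants, which stay in the class.
\<close>

lemma bondage_induced_free:
  assumes d: "d \<ge> 1" and H: "simple_graph H" "min_degree H \<ge> 2"
    and C: "C = {G \<in> graphs. induced_free H G}" and ds: "dominating_set_poly_time C"
  shows "bondage_poly_time d C"
proof -
  obtain M pol where M: "wf_tm M" and sol: "solves_domination M pol C"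
    using ds unfolding dominating_set_poly_time_def poly_time_solvable_def solves_domination_def by fastforce
  interpret calling M "4 * d + 5" by unfold_locales (rule M)
  have Cg: "C \<subseteq> graphs" using C by auto
  let ?m = "Suc (2 * d)"
  let ?P = "\<lambda>G xs. G \<in> C \<and> (\<forall>l<d. {xs ! l, xs ! (d + l)} \<in> edges G)"
  have edge: "decides False (Suc (Suc m)) P (\<lambda>G vs. {vs ! m, vs ! Suc m} \<in> edges G)" if "m \<le> 4 * d + 1" for m P
    by (rule decides_edge) (use that in auto)
  have 1: "decides True ?m (\<lambda>G us. ?P G (take (2 * d) us)) (\<lambda>G us. domination_number G \<le> Suc (us ! (2 * d)))"
    by (rule decides_domination[OF _ _ sol edge, where p = 0 and G' = "\<lambda>G us. G" and \<chi> = "\<lambda>_ _ _. True"])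
       (use d in \<open>auto simp: valid_def nth_append\<close>)
  have 2: "decides True ?m (\<lambda>G us. ?P G (take (2 * d) us))
      (\<lambda>G us. domination_number (delete_edges G (edge_set d us)) \<le> Suc (us ! (2 * d)))"
  proof -
    \<comment> \<open>Here \<open>ws\<close> consists of the ends of the edges, the threshold, and the chosen dominators.\<close>
    let ?D = "\<lambda>G ws. \<forall>m<2 * d. ws ! (?m + m) = ws ! m \<or>
        {ws ! (?m + m), ws ! m} \<in> edges (delete_edges G (edge_set d ws))"
    let ?A = "\<lambda>G ws. domination_number (add_pendants G (drop ?m ws)) \<le> Suc (ws ! (2 * d))"
    let ?Q = "\<lambda>G ws. ?P G (take (2 * d) (take ?m ws))"
    have dom: "decides True (?m + 2 * d) ?Q ?D"
      by (intro decides_all_less decides_or decides_eq decides_remaining_edge) auto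
    have "decides True (?m + 2 * d) (\<lambda>G ws. ?Q G ws \<and> ?D G ws) ?A"
    proof (rule decides_domination[OF _ _ sol edge, where p = "2 * d"
          and \<chi> = "\<lambda>q G vs. vs ! (?m + q) = vs ! (?m + 2 * d)"])
      show "decides False (Suc (?m + 2 * d)) (\<lambda>_ _. True) (\<lambda>G vs. vs ! (?m + q) = vs ! (?m + 2 * d))"
        if "q < 2 * d" for q
        by (rule decides_eq) (use that in auto)
      fix G ws
      assume v: "valid (?m + 2 * d) G ws" and "?Q G ws \<and> ?D G ws"
      then have GC: "G \<in> C" and G: "G \<in> graphs" using Cg by auto
      have len: "length ws = ?m + 2 * d" using v by (simp add: valid_def)
      have ys: "set (drop ?m ws) \<subseteq> verts G"
        using v verts_graphs[OF G] set_drop_subset[of ?m ws] unfolding valid_def by blast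
      show "add_pendants G (drop ?m ws) \<in> C \<and> vcount (add_pendants G (drop ?m ws)) = vcount G + 2 * d"
        using GC induced_free_add_pendants[OF H _ G ys] add_pendants_in_graphs[OF G ys] len
        unfolding C by (simp add: add_pendants_def)
      note E = add_pendants_edges[OF G ys]
      show "({i, j} \<in> edges (add_pendants G (drop ?m ws))) =
         ({(ws @ [i, j]) ! (?m + 2 * d), (ws @ [i, j]) ! Suc (?m + 2 * d)} \<in> edges G)"
        if "i < vcount G" "j < vcount G" for i j
        using E(1)[OF that] len by (simp add: nth_append)
      show "({i, vcount G + q} \<in> edges (add_pendants G (drop ?m ws))) =
         ((ws @ [i]) ! (?m + q) = (ws @ [i]) ! (?m + 2 * d))" if "i < vcount G" "q < 2 * d" for i q
        using E(2)[of q i] that len by (auto simp: nth_append)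
      show "{vcount G + q, vcount G + r} \<notin> edges (add_pendants G (drop ?m ws))" if "q < 2 * d" "r < 2 * d" for q r
      proof -
        have "drop ?m ws ! r \<in> verts G" using ys nth_mem[of r "drop ?m ws"] that len by auto
        then have "drop ?m ws ! r < vcount G" using mem_verts_iff[OF G] by blast
        then show ?thesis using E(2)[of r "vcount G + q"] that len by auto
      qed
    qed (use d in auto)
    from decides_ex_list[OF decides_and[OF dom this]]
    have "decides True ?m (\<lambda>G us. ?P G (take (2 * d) us)) (\<lambda>G us. \<exists>ys. length ys = 2 * d \<and>
       set ys \<subseteq> {..<vcount G} \<and> ?D G (us @ ys) \<and> ?A G (us @ ys))" .
    then show ?thesis
    proof (rule decides_cong)
      fix G us
      assume v: "valid ?m G us" and P: "?P G (take (2 * d) us)"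
      have G: "G \<in> graphs" using P Cg by auto
      have len: "length us = ?m" using v by (simp add: valid_def)
      let ?xs = "take (2 * d) us"
      have es: "edge_set d (us @ ys) = edge_set d ?xs" "edge_set d us = edge_set d ?xs" for ys
        unfolding edge_set_def by (intro image_cong; auto simp: nth_append len)+
      have xs: "set ?xs \<subseteq> verts G" "length ?xs = 2 * d"
        using v verts_graphs[OF G] set_take_subset[of "2 * d" us] len unfolding valid_def by auto
      have D: "?D G (us @ ys) \<longleftrightarrow> (\<forall>m<2 * d. ys ! m = ?xs ! m \<or> {ys ! m, ?xs ! m} \<in> edges (delete_edges G (edge_set d ?xs)))"
        for ys
        unfolding es by (simp add: nth_append len)
      have A: "?A G (us @ ys) \<longleftrightarrow> domination_number (add_pendants G ys) \<le> Suc (us ! (2 * d))" for ys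
        by (simp add: nth_append len)
      show "?P G (take (2 * d) us) \<and> (domination_number (delete_edges G (edge_set d us)) \<le> Suc (us ! (2 * d))) =
        (\<exists>ys. length ys = 2 * d \<and> set ys \<subseteq> {..<vcount G} \<and> ?D G (us @ ys) \<and> ?A G (us @ ys))"
        unfolding D A es(2) domination_number_delete_iff_pendants[OF G xs]
        using P verts_graphs[OF G] by simp
    qed
  qed
  show ?thesis
    by (rule bondage_via_lists[OF d Cg increase_via_threshold[OF Cg d _ _ 1 2]]) auto
qed

text \<open>
  \<open>\<gamma>(G)\<close> is one of finitely many thresholds, and for each of them the existence of a small dominating set
  is expressed by quantifiers. The formula \<open>\<epsilon>\<close> below stands for adjacency in the graph to be dominated.
\<close>

lemma bondage_bounded_domination:
  assumes d: "d \<ge> 1" and C: "C \<subseteq> graphs" and k: "\<And>G. G \<in> C \<Longrightarrow> domination_number G \<le> k"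
  shows "bondage_poly_time d C"
proof -
  \<comment> \<open>The programs are stated relative to a machine that may be called; here any machine will do.\<close>
  define M where "M = \<lparr>num_tapes = 1, num_symbols = 3, num_states = 2, start_state = 0,
     accept_state = 0, reject_state = 1, delta = \<lambda>_ _. (0, [(0, Stay)])\<rparr>"
  have "wf_tm M" by (auto simp: wf_tm_def M_def)
  interpret calling M "2 * d + k + 5" by unfold_locales (rule \<open>wf_tm M\<close>)
  let ?P = "\<lambda>G xs. G \<in> C \<and> (\<forall>l<d. {xs ! l, xs ! (d + l)} \<in> edges G)"
  let ?m = "2 * d"
  have dominated: "decides True ?m ?P (\<lambda>G xs. \<exists>zs. length zs = j \<and> set zs \<subseteq> {..<vcount G} \<and>
     \<not> (\<exists>v<vcount G. \<not> (\<exists>i<j. (((xs @ zs) @ [v]) ! (?m + i) = ((xs @ zs) @ [v]) ! (?m + j) \<or>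
        \<epsilon> ((xs @ zs) @ [v]) {((xs @ zs) @ [v]) ! (?m + i), ((xs @ zs) @ [v]) ! (?m + j)} G))))"
    if eps: "\<And>i P. i < j \<Longrightarrow> decides True (Suc (?m + j)) P (\<lambda>G vs. \<epsilon> vs {vs ! (?m + i), vs ! (?m + j)} G)" and j: "j \<le> k"
    for j and \<epsilon> :: "nat list \<Rightarrow> nat set \<Rightarrow> nat graph \<Rightarrow> bool"
  proof (rule decides_ex_list, rule decides_not, rule decides_ex)
    show "decides True (Suc (?m + j)) (\<lambda>_ _. True)
      (\<lambda>G vs. \<not> (\<exists>i<j. vs ! (?m + i) = vs ! (?m + j) \<or> \<epsilon> vs {vs ! (?m + i), vs ! (?m + j)} G))"
      by (intro decides_not decides_ex_less decides_or decides_eq eps) (use j in auto)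
  qed simp
  \<comment> \<open>The case \<open>d' = 0\<close> is \<open>G\<close> itself: no edge is deleted.\<close>
  have all: "decides True ?m ?P (\<lambda>G xs. domination_number (delete_edges G (edge_set d' xs)) \<le> j)"
    if j: "j \<le> k" and d': "d' = 0 \<or> d' = d" for j d'
  proof (rule decides_cong[OF dominated[OF _ j, where \<epsilon> = "\<lambda>vs e G. e \<in> edges (delete_edges G (edge_set d' vs))"]])
    show "decides True (Suc (?m + j)) P (\<lambda>G vs. {vs ! (?m + i), vs ! (?m + j)} \<in> edges (delete_edges G (edge_set d' vs)))"
      if "i < j" for i P
      by (rule decides_remaining_edge) (use that j d' in auto)
    fix G xs
    assume v: "valid ?m G xs" and P: "?P G xs"
    have G: "G \<in> graphs" using P C by auto
    let ?G = "delete_edges G (edge_set d' xs)"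
    have len: "length xs = ?m" using v by (simp add: valid_def)
    have "set xs \<noteq> {}" using len d by auto
    then have ne: "verts ?G \<noteq> {}" using v by (auto simp: valid_def)
    have sg: "simple_graph ?G" by (rule simple_graph_delete_edges[OF simple_graph_if_graphs[OF G]])
    have es: "edge_set d' ((xs @ zs) @ [v]) = edge_set d' xs" for zs v
      unfolding edge_set_def using d' by (intro image_cong) (auto simp: nth_append len)
    have at: "((xs @ zs) @ [v]) ! (?m + i) = zs ! i" "((xs @ zs) @ [v]) ! (?m + j) = v"
      if "length zs = j" "i < j" for zs v i
      using that len by (auto simp: nth_append)
    have V: "v \<in> verts ?G \<longleftrightarrow> v < vcount G" "set zs \<subseteq> verts ?G \<longleftrightarrow> set zs \<subseteq> {..<vcount G}" for v zs
      using verts_graphs[OF G] mem_verts_iff[OF G] by auto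
    show "?P G xs \<and> (domination_number ?G \<le> j) = (\<exists>zs. length zs = j \<and> set zs \<subseteq> {..<vcount G} \<and>
     \<not> (\<exists>v<vcount G. \<not> (\<exists>i<j. (((xs @ zs) @ [v]) ! (?m + i) = ((xs @ zs) @ [v]) ! (?m + j) \<or>
        {((xs @ zs) @ [v]) ! (?m + i), ((xs @ zs) @ [v]) ! (?m + j)} \<in> edges (delete_edges G (edge_set d' ((xs @ zs) @ [v])))))))"
      unfolding domination_number_le_iff_list[OF sg ne] es Ball_def V
      using P at by (intro conjI ex_cong1) (simp_all cong: conj_cong)
  qed
  have "decides True ?m ?P (\<lambda>G xs. \<exists>j<Suc k. domination_number (delete_edges G (edge_set 0 xs)) \<le> j \<and>
     \<not> domination_number (delete_edges G (edge_set d xs)) \<le> j)"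
  proof (rule decides_ex_less)
    fix j assume "j < Suc k"
    then have j: "j \<le> k" by simp
    have "decides True ?m (\<lambda>G xs. ?P G xs \<and> domination_number (delete_edges G (edge_set 0 xs)) \<le> j)
       (\<lambda>G xs. \<not> domination_number (delete_edges G (edge_set d xs)) \<le> j)"
      by (rule decides_cong[OF decides_not[OF all[OF j, of d]]]) auto
    from decides_and[OF all[OF j, of 0] this]
    show "decides True ?m ?P (\<lambda>G xs. domination_number (delete_edges G (edge_set 0 xs)) \<le> j \<and>
       \<not> domination_number (delete_edges G (edge_set d xs)) \<le> j)" by simp
  qed simp
  then have "decides True ?m ?P (\<lambda>G xs. domination_number G < domination_number (delete_edges G (edge_set d xs)))"
  proof (rule decides_cong)
    fix G xs
    assume P: "?P G xs"
    have "edge_set 0 xs = {}" by (simp add: edge_set_def)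
    moreover have "(\<exists>j<Suc k. a \<le> j \<and> \<not> b \<le> j) \<longleftrightarrow> a < b" if "a \<le> k" for a b :: nat
      using that by (metis le_less_trans less_Suc_eq_le linorder_not_le order_refl)
    ultimately show "?P G xs \<and> (domination_number G < domination_number (delete_edges G (edge_set d xs))) =
     (\<exists>j<Suc k. domination_number (delete_edges G (edge_set 0 xs)) \<le> j \<and>
     \<not> domination_number (delete_edges G (edge_set d xs)) \<le> j)"
      using P k by simp
  qed
  then show ?thesis by (rule bondage_via_lists[OF d C]) simp
qed

theorem proposition4p9:
  fixes d :: nat and C :: "nat graph set"
  assumes "d \<ge> 1"
    and "C \<subseteq> graphs"
    and "(closed_under_edge_deletions C \<and> dominating_set_poly_time C)
       \<or> ((\<exists>H :: nat graph. simple_graph H \<and> verts H \<noteq> {} \<and> min_degree H \<ge> 2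
             \<and> C = {G \<in> graphs. induced_free H G})
           \<and> dominating_set_poly_time C)
       \<or> (\<exists>k :: nat. \<forall>G\<in>C. domination_number G \<le> k)"
  shows "bondage_poly_time d C"
  using assms(3)
proof (elim disjE conjE exE)
  show "closed_under_edge_deletions C \<Longrightarrow> dominating_set_poly_time C \<Longrightarrow> bondage_poly_time d C"
    by (rule bondage_closed_under_deletion[OF assms(1,2)])
  show "bondage_poly_time d C"
    if "dominating_set_poly_time C" "simple_graph H" "min_degree H \<ge> 2"
      "C = {G \<in> graphs. induced_free H G}" for H :: "nat graph"
    using bondage_induced_free[OF assms(1) that(2-4,1)] .
  show "\<forall>G\<in>C. domination_number G \<le> k \<Longrightarrow> bondage_poly_time d C" for k
    using bondage_bounded_domination[OF assms(1,2), of k] by blast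
qed

end
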